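(* The structure space $\mathfrak{M}_{\mathbb{K}}$ of $\mathbb{K}\langle z\rangle$ is homeomorphic to $\theta\mathbb{K}$.
   Context: $\mathbb{K}\langle z\rangle$ denotes any one of the following three rings: (1) the ring $\mathbb{C}\langle z\rangle$ of complex entire functions of one variable; (2) the ring $\mathbb{C}\langle x\rangle$ of convergent power series $\sum_{n\ge 0}a_nz^n$ in one complex variable $z\in\mathbb{C}$ with real coefficients $a_n\in\mathbb{R}$; (3) the ring $\mathbb{R}\langle x\rangle$ of real analytic functions of one real variable (functions on $\mathbb{R}$ given locally by convergent real power series). $\mathbb{K}$ is the underlying field: $\mathbb{C}$ in cases (1), (2) and $\mathbb{R}$ in case (3), with its usual topology. The structure space $\mathfrak{M}_{\mathbb{K}}$ is the set of all maximal ideals of $\mathbb{K}\langle z\rangle$ with the Stone topology: the sets $M(f)=\{M\in\mathfrak{M}_{\mathbb{K}}: f\in M\}$, $f\in\mathbb{K}\langle z\rangle$, form a base for the closed sets. $\mathcal{D}(\mathbb{K})$ is the collection of all closed discrete subsets of $\mathbb{K}$ together with the special member $\mathbb{K}$ itself. A discrete $z$-filter on $\mathbb{K}$ is a collection $\mathcal{F}$ of members of $\mathcal{D}(\mathbb{K})$ such that $\emptyset\notin\mathcal{F}$; $D_1,D_2\in\mathcal{F}$ implies $D_1\cap D_2\in\mathcal{F}$; and $D_1\in\mathcal{F}$, $D\in\mathcal{D}(\mathbb{K})$, $D_1\subseteq D$ imply $D\in\mathcal{F}$. A discrete $z$-ultrafilter is a discrete $z$-filter that is maximal under inclusion. $\theta\mathbb{K}$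 is the set of all discrete $z$-ultrafilters on $\mathbb{K}$, regarded as an index set: $\mathcal{D}^p$ is the discrete $z$-ultrafilter corresponding to the point $p\in\theta\mathbb{K}$. It is topologized by taking as basic closed sets the sets $\overline{Z}=\{p\in\theta\mathbb{K}: Z\in\mathcal{D}^p\}$, for $Z$ a closed discrete subset of $\mathbb{K}$. *)

theory Defs
  imports "HOL-Analysis.Analysis" "HOL-Algebra.Ideal"
begin

section \<open>The function rings\<close>

definition function_ring :: "('a \<Rightarrow> 'b::comm_ring_1) set \<Rightarrow> ('a \<Rightarrow> 'b) ring"
  where "function_ring A =
    \<lparr>carrier = A, mult = (\<lambda>f g x. f x * g x), one = (\<lambda>x. 1),
     zero = (\<lambda>x. 0), add = (\<lambda>f g x. f x + g x)\<rparr>"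

definition entire_ring :: "(complex \<Rightarrow> complex) ring"
  where "entire_ring = function_ring {f. f holomorphic_on UNIV}"

text \<open>Convergence is convergence at every point of the complex plane: the elements are the
  entire functions whose Taylor coefficients at 0 are real.\<close>

definition real_entire_ring :: "(complex \<Rightarrow> complex) ring"
  where "real_entire_ring = function_ring
    {f. \<exists>a::nat \<Rightarrow> real. \<forall>z. (\<lambda>n. complex_of_real (a n) * z ^ n) sums f z}"

definition real_analytic_ring :: "(real \<Rightarrow> real) ring"
  where "real_analytic_ring = function_ring
    {f. \<forall>x. \<exists>F. (\<lambda>h. f (x + h)) has_fps_expansion F}"


section \<open>Structure spaces\<close>

definition maximal_ideals :: "('a, 'm) ring_scheme \<Rightarrow> 'a set set"
  where "maximal_ideals R = {M. maximalideal M R}"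

definition maximal_ideals_containing :: "('a, 'm) ring_scheme \<Rightarrow> 'a \<Rightarrow> 'a set set"
  where "maximal_ideals_containing R f = {M \<in> maximal_ideals R. f \<in> M}"

text \<open>A family of sets is a base for the closed sets iff the complements form a base for the open
  sets. That the complements below are indeed a base, so that \<^const>\<open>topology\<close> is applied to
  a genuine topology, is shown in \<open>openin_structure_space\<close> and \<open>openin_theta_space\<close>.\<close>

definition structure_space :: "('a, 'm) ring_scheme \<Rightarrow> 'a set topology"
  where "structure_space R = topology (arbitrary union_of
    (\<lambda>U. \<exists>f\<in>carrier R. U = maximal_ideals R - maximal_ideals_containing R f))"


section \<open>Discrete z-ultrafilters\<close>

definition discrete_zsets :: "'a::topological_space set set"
  where "discrete_zsets = {D. closed D \<and> discrete D} \<union> {UNIV}"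

definition discrete_zfilter :: "'a::topological_space set set \<Rightarrow> bool"
  where "discrete_zfilter \<F> \<longleftrightarrow>
    \<F> \<subseteq> discrete_zsets \<and> {} \<notin> \<F> \<and>
    (\<forall>D1\<in>\<F>. \<forall>D2\<in>\<F>. D1 \<inter> D2 \<in> \<F>) \<and>
    (\<forall>D1\<in>\<F>. \<forall>D\<in>discrete_zsets. D1 \<subseteq> D \<longrightarrow> D \<in> \<F>)"

definition discrete_zultrafilter :: "'a::topological_space set set \<Rightarrow> bool"
  where "discrete_zultrafilter \<F> \<longleftrightarrow>
    discrete_zfilter \<F> \<and> (\<forall>\<G>. discrete_zfilter \<G> \<and> \<F> \<subseteq> \<G> \<longrightarrow> \<G> = \<F>)"

text \<open>A point of the space is identified with the ultrafilter it indexes.\<close>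

definition theta :: "'a::topological_space set set set"
  where "theta = {p. discrete_zultrafilter p}"

definition theta_closure :: "'a::topological_space set \<Rightarrow> 'a set set set"
  where "theta_closure Z = {p \<in> theta. Z \<in> p}"

definition theta_space :: "'a::topological_space set set topology"
  where "theta_space = topology (arbitrary union_of
    (\<lambda>U. \<exists>Z. closed Z \<and> discrete Z \<and> U = theta - theta_closure Z))"


section \<open>The rings are commutative rings\<close>

lemma cring_function_ring:
  assumes "(\<lambda>x. 0) \<in> A" "(\<lambda>x. 1) \<in> A"
    and "\<And>f g. f \<in> A \<Longrightarrow> g \<in> A \<Longrightarrow> (\<lambda>x. f x + g x) \<in> A"
    and "\<And>f g. f \<in> A \<Longrightarrow> g \<in> A \<Longrightarrow> (\<lambda>x. f x * g x) \<in> A"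
    and "\<And>f. f \<in> A \<Longrightarrow> (\<lambda>x. - f x) \<in> A"
  shows "cring (function_ring A)"
proof (rule cringI)
  show "abelian_group (function_ring A)"
  proof (rule abelian_groupI)
    fix f assume "f \<in> carrier (function_ring A)"
    then show "\<exists>g\<in>carrier (function_ring A).
        g \<oplus>\<^bsub>function_ring A\<^esub> f = \<zero>\<^bsub>function_ring A\<^esub>"
      by (intro bexI[of _ "\<lambda>x. - f x"]) (use assms(5) in \<open>auto simp: function_ring_def\<close>)
  qed (use assms in \<open>auto simp: function_ring_def algebra_simps\<close>)
  show "Group.comm_monoid (function_ring A)"
    by (rule comm_monoidI) (use assms in \<open>auto simp: function_ring_def algebra_simps\<close>)
qed (auto simp: function_ring_def algebra_simps)

lemma cring_entire_ring: "cring entire_ring"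
  unfolding entire_ring_def
  by (rule cring_function_ring) (auto intro!: holomorphic_intros)

lemma cring_real_entire_ring: "cring real_entire_ring"
  unfolding real_entire_ring_def
proof (rule cring_function_ring, goal_cases)
  case 1
  show ?case by (auto intro!: exI[of _ "\<lambda>n. 0"])
next
  case 2
  have "(\<lambda>n. complex_of_real (if n = 0 then 1 else 0) * z ^ n) sums 1" for z
    using sums_If_finite[of "\<lambda>n. n = 0" "\<lambda>n. z ^ n"]
    by (simp add: if_distrib[of complex_of_real] if_distrib[of "\<lambda>c. c * _"] cong: if_cong)
  then show ?case by (intro CollectI exI[of _ "\<lambda>n. if n = 0 then 1 else 0"] allI)
next
  case (3 f g)
  then obtain a b where "\<And>z. (\<lambda>n. complex_of_real (a n) * z ^ n) sums f z"
    "\<And>z. (\<lambda>n. complex_of_real (b n) * z ^ n) sums g z" by blast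
  then have "(\<lambda>n. complex_of_real (a n + b n) * z ^ n) sums (f z + g z)" for z
    using sums_add[of "\<lambda>n. complex_of_real (a n) * z ^ n" "f z"
        "\<lambda>n. complex_of_real (b n) * z ^ n" "g z"] by (simp add: ring_distribs)
  then show ?case by (intro CollectI exI allI)
next
  case (4 f g)
  then obtain a b where a: "\<And>z. (\<lambda>n. complex_of_real (a n) * z ^ n) sums f z"
    and b: "\<And>z. (\<lambda>n. complex_of_real (b n) * z ^ n) sums g z" by blast
  have abs: "summable (\<lambda>n. norm (complex_of_real (c n) * z ^ n))"
    if "\<And>z. (\<lambda>n. complex_of_real (c n) * z ^ n) sums h z" for c h z
  proof (rule powser_insidea)
    show "summable (\<lambda>n. complex_of_real (c n) * of_real (norm z + 1) ^ n)"
      by (rule sums_summable[OF that])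
    show "norm z < norm (complex_of_real (norm z + 1))"
      by (simp only: norm_of_real)
  qed
  have "(\<lambda>n. complex_of_real (\<Sum>i\<le>n. a i * b (n - i)) * z ^ n) sums (f z * g z)" for z
  proof -
    have "(\<lambda>n. \<Sum>i\<le>n. (complex_of_real (a i) * z ^ i) * (complex_of_real (b (n - i)) * z ^ (n - i)))
        sums (f z * g z)"
      using Cauchy_product_sums[OF abs[OF a] abs[OF b], of z] a b by (simp add: sums_iff)
    moreover have "(\<Sum>i\<le>n. (complex_of_real (a i) * z ^ i) * (complex_of_real (b (n - i)) * z ^ (n - i)))
        = complex_of_real (\<Sum>i\<le>n. a i * b (n - i)) * z ^ n" for n
      unfolding of_real_sum sum_distrib_right
      by (intro sum.cong) (auto simp flip: power_add)
    ultimately show ?thesis by simp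
  qed
  then show ?case by (intro CollectI exI allI)
next
  case (5 f)
  then obtain a where "\<And>z. (\<lambda>n. complex_of_real (a n) * z ^ n) sums f z" by blast
  then have "(\<lambda>n. complex_of_real (- a n) * z ^ n) sums (- f z)" for z
    using sums_minus[of "\<lambda>n. complex_of_real (a n) * z ^ n" "f z"] by simp
  then show ?case by (intro CollectI exI allI)
qed

lemma cring_real_analytic_ring: "cring real_analytic_ring"
  unfolding real_analytic_ring_def
proof (rule cring_function_ring, unfold mem_Collect_eq)
  fix f g :: "real \<Rightarrow> real"
  assume f: "\<forall>x. \<exists>F. (\<lambda>h. f (x + h)) has_fps_expansion F"
  show "\<forall>x. \<exists>F. (\<lambda>h. - f (x + h)) has_fps_expansion F"
  proof
    fix x
    obtain F where "(\<lambda>h. f (x + h)) has_fps_expansion F" using f by blast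
    from has_fps_expansion_minus[OF this]
    show "\<exists>F. (\<lambda>h. - f (x + h)) has_fps_expansion F" ..
  qed
  assume g: "\<forall>x. \<exists>F. (\<lambda>h. g (x + h)) has_fps_expansion F"
  show "\<forall>x. \<exists>F. (\<lambda>h. f (x + h) + g (x + h)) has_fps_expansion F"
    "\<forall>x. \<exists>F. (\<lambda>h. f (x + h) * g (x + h)) has_fps_expansion F"
  proof safe
    fix x
    obtain F G where FG: "(\<lambda>h. f (x + h)) has_fps_expansion F"
      "(\<lambda>h. g (x + h)) has_fps_expansion G"
      using f g by blast
    show "\<exists>F. (\<lambda>h. f (x + h) + g (x + h)) has_fps_expansion F"
      using has_fps_expansion_add[OF FG] ..
    show "\<exists>F. (\<lambda>h. f (x + h) * g (x + h)) has_fps_expansion F"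
      using has_fps_expansion_mult[OF FG] ..
  qed
next
  show "\<forall>x. \<exists>F. (\<lambda>h. 0::real) has_fps_expansion F"
    using has_fps_expansion_0 by blast
  show "\<forall>x. \<exists>F. (\<lambda>h. 1::real) has_fps_expansion F"
    using has_fps_expansion_1 by blast
qed


section \<open>The bases are bases\<close>

lemma openin_structure_space:
  assumes "cring R"
  shows "openin (structure_space R) = arbitrary union_of
    (\<lambda>U. \<exists>f\<in>carrier R. U = maximal_ideals R - maximal_ideals_containing R f)"
  unfolding structure_space_def
proof (rule topology_inverse'[OF istopology_base])
  fix S T
  assume "\<exists>f\<in>carrier R. S = maximal_ideals R - maximal_ideals_containing R f"
    and "\<exists>f\<in>carrier R. T = maximal_ideals R - maximal_ideals_containing R f"
  then obtain f g where f: "f \<in> carrier R" and g: "g \<in> carrier R"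
    and S: "S = maximal_ideals R - maximal_ideals_containing R f"
    and T: "T = maximal_ideals R - maximal_ideals_containing R g" by blast
  have "f \<otimes>\<^bsub>R\<^esub> g \<in> M \<longleftrightarrow> f \<in> M \<or> g \<in> M" if "maximalideal M R" for M
    using primeideal.I_prime[OF cring.maximalideal_prime[OF assms that] f g]
      ideal.I_l_closed[OF maximalideal.axioms(1)[OF that], of g f]
      ideal.I_r_closed[OF maximalideal.axioms(1)[OF that], of f g] f g by blast
  then have "S \<inter> T = maximal_ideals R - maximal_ideals_containing R (f \<otimes>\<^bsub>R\<^esub> g)"
    unfolding S T maximal_ideals_def maximal_ideals_containing_def by blast
  moreover have "f \<otimes>\<^bsub>R\<^esub> g \<in> carrier R"
    using cring.cring_simprules(5)[OF assms f g] .
  ultimately show "\<exists>f\<in>carrier R. S \<inter> T = maximal_ideals R - maximal_ideals_containing R f"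
    by blast
qed

lemma topspace_structure_space:
  assumes "cring R"
  shows "topspace (structure_space R) = maximal_ideals R"
proof -
  interpret cring R by fact
  have "\<one>\<^bsub>R\<^esub> \<notin> M" if "maximalideal M R" for M
    using that ideal.one_imp_carrier maximalideal.I_notcarr maximalideal.axioms(1) by metis
  then have "maximal_ideals R = maximal_ideals R - maximal_ideals_containing R \<one>\<^bsub>R\<^esub>"
    by (auto simp: maximal_ideals_def maximal_ideals_containing_def)
  then have "openin (structure_space R) (maximal_ideals R)"
    unfolding openin_structure_space[OF assms] by (intro arbitrary_union_of_inc) blast
  moreover have "U \<subseteq> maximal_ideals R" if "openin (structure_space R) U" for U
    using that unfolding openin_structure_space[OF assms] union_of_def arbitrary_def by auto
  ultimately show ?thesis
    by (metis openin_subset openin_topspace subset_antisym)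
qed

lemma closed_discrete_iff:
  fixes D :: "'a::topological_space set"
  shows "closed D \<and> discrete D \<longleftrightarrow> (\<forall>x. \<forall>\<^sub>F y in at x. y \<notin> D)"
proof (intro iffI allI)
  fix x assume D: "closed D \<and> discrete D"
  show "\<forall>\<^sub>F y in at x. y \<notin> D"
  proof (cases "x \<in> D")
    case False
    then show ?thesis
      using D by (auto simp: eventually_at_topological closed_def intro!: exI[of _ "- D"])
  qed (use D discrete_altdef in blast)
next
  assume D: "\<forall>x. \<forall>\<^sub>F y in at x. y \<notin> D"
  then have "closed D"
    by (auto simp: closed_limpt islimpt_iff_eventually)
  with D show "closed D \<and> discrete D"
    by (auto simp: discrete_altdef)
qed

lemma closed_discrete_Un:
  fixes A B :: "'a::topological_space set"
  assumes "closed A \<and> discrete A" "closed B \<and> discrete B"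
  shows "closed (A \<union> B) \<and> discrete (A \<union> B)"
  using assms unfolding closed_discrete_iff by (simp add: eventually_conj_iff)

lemma closed_discrete_Int:
  fixes A B :: "'a::topological_space set"
  assumes "closed A \<and> discrete A"
  shows "closed (A \<inter> B) \<and> discrete (A \<inter> B)"
  unfolding closed_discrete_iff
proof
  fix x
  have "\<forall>\<^sub>F y in at x. y \<notin> A"
    using assms closed_discrete_iff by blast
  then show "\<forall>\<^sub>F y in at x. y \<notin> A \<inter> B"
    by (rule eventually_mono) blast
qed

lemma discrete_zsets_Int:
  "A \<in> discrete_zsets \<Longrightarrow> B \<in> discrete_zsets \<Longrightarrow> A \<inter> B \<in> discrete_zsets"
  unfolding discrete_zsets_def using closed_discrete_Int[of A B] by auto

lemma discrete_zultrafilter_meets: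
  assumes p: "discrete_zultrafilter p" and Z: "Z \<in> discrete_zsets" "Z \<notin> p"
  obtains D where "D \<in> p" "D \<inter> Z = {}"
proof (rule ccontr)
  assume contr: "\<not> thesis"
  define q where qeq: "q = {E \<in> discrete_zsets. \<exists>D\<in>p. D \<inter> Z \<subseteq> E}"
  have pf: "discrete_zfilter p"
    using p by (simp add: discrete_zultrafilter_def)
  have ne: "D \<inter> Z \<noteq> {}" if "D \<in> p" for D
    using that contr \<open>\<And>D. D \<in> p \<Longrightarrow> D \<inter> Z = {} \<Longrightarrow> thesis\<close> by blast
  have UNIVz: "UNIV \<in> discrete_zsets"
    by (simp add: discrete_zsets_def)
  have "p \<noteq> {}"
  proof
    assume "p = {}"
    moreover have "discrete_zfilter {UNIV :: 'a set}"
      using UNIVz by (auto simp: discrete_zfilter_def)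
    ultimately show False
      using p unfolding discrete_zultrafilter_def by blast
  qed
  have "discrete_zfilter q"
    unfolding discrete_zfilter_def
  proof (intro conjI ballI impI)
    show "q \<subseteq> discrete_zsets" "{} \<notin> q" using ne by (auto simp: qeq)
  next
    fix A B assume "A \<in> q" "B \<in> q"
    then obtain D E where DE: "D \<in> p" "D \<inter> Z \<subseteq> A" "E \<in> p" "E \<inter> Z \<subseteq> B"
      and z: "A \<in> discrete_zsets" "B \<in> discrete_zsets" by (auto simp: qeq)
    moreover have "D \<inter> E \<in> p" using DE pf by (auto simp: discrete_zfilter_def)
    ultimately show "A \<inter> B \<in> q"
      using discrete_zsets_Int[OF z] by (auto simp: qeq intro!: bexI[of _ "D \<inter> E"])
  next
    fix A B assume "A \<in> q" "B \<in> discrete_zsets" "A \<subseteq> B"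
    then show "B \<in> q" by (auto simp: qeq)
  qed
  moreover have "p \<subseteq> q" using pf by (auto simp: qeq discrete_zfilter_def)
  moreover have "Z \<in> q" using Z \<open>p \<noteq> {}\<close> by (auto simp: qeq)
  ultimately show False
    using p Z unfolding discrete_zultrafilter_def by blast
qed

lemma discrete_zultrafilter_Un_iff:
  assumes p: "discrete_zultrafilter p"
    and A: "closed A" "discrete A" and B: "closed B" "discrete B"
  shows "A \<union> B \<in> p \<longleftrightarrow> A \<in> p \<or> B \<in> p"
proof
  have pf: "discrete_zfilter p"
    using p by (simp add: discrete_zultrafilter_def)
  have z: "A \<in> discrete_zsets" "B \<in> discrete_zsets" "A \<union> B \<in> discrete_zsets"
    using A B closed_discrete_Un[of A B] by (auto simp: discrete_zsets_def)
  show "A \<in> p \<or> B \<in> p" if AB: "A \<union> B \<in> p"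
  proof (rule ccontr)
    assume "\<not> (A \<in> p \<or> B \<in> p)"
    then obtain D E where DE: "D \<in> p" "D \<inter> A = {}" "E \<in> p" "E \<inter> B = {}"
      using discrete_zultrafilter_meets[OF p] z by metis
    then have "D \<inter> E \<inter> (A \<union> B) \<in> p"
      using AB pf by (auto simp: discrete_zfilter_def)
    moreover have "D \<inter> E \<inter> (A \<union> B) = {}" using DE by blast
    ultimately show False using pf by (simp add: discrete_zfilter_def)
  qed
  show "A \<union> B \<in> p" if "A \<in> p \<or> B \<in> p"
    using that pf z by (auto simp: discrete_zfilter_def)
qed

lemma openin_theta_space:
  "openin (theta_space :: 'a::topological_space set set topology) = arbitrary union_of
    (\<lambda>U. \<exists>Z. closed Z \<and> discrete Z \<and> U = theta - theta_closure Z)"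
  unfolding theta_space_def
proof (rule topology_inverse'[OF istopology_base], elim exE conjE)
  fix S T and A B :: "'a set"
  assume AB: "closed A" "discrete A" "closed B" "discrete B"
    and "S = theta - theta_closure A" "T = theta - theta_closure B"
  then have "S \<inter> T = theta - theta_closure (A \<union> B)"
    using discrete_zultrafilter_Un_iff by (auto simp: theta_def theta_closure_def)
  then show "\<exists>Z. closed Z \<and> discrete Z \<and> S \<inter> T = theta - theta_closure Z"
    using AB closed_discrete_Un by blast
qed

lemma topspace_theta_space:
  "topspace (theta_space :: 'a::topological_space set set topology) = theta"
proof -
  have "theta = theta - theta_closure ({} :: 'a set)"
    by (auto simp: theta_def theta_closure_def discrete_zultrafilter_def discrete_zfilter_def)
  then have "openin theta_space (theta :: 'a set set set)"
    unfolding openin_theta_space by (intro arbitrary_union_of_inc) (metis closed_empty discrete_empty)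
  moreover have "U \<subseteq> theta" if "openin theta_space U" for U :: "'a set set set"
    using that unfolding openin_theta_space union_of_def arbitrary_def by auto
  ultimately show ?thesis
    by (metis openin_subset openin_topspace subset_antisym)
qed

end

theory Submission
  imports Defs "HOL-Complex_Analysis.Complex_Analysis"
begin

text \<open>
  A maximal ideal \<open>M\<close> corresponds to the discrete z-ultrafilter of the zero sets of its elements, and an
  ultrafilter \<open>p\<close> to the ideal of all functions whose zero set is in \<open>p\<close>. Three properties of the ring
  make this work: the zero set of a nonzero function is closed and discrete; every closed discrete set
  is the zero set of a function; and two functions without common zeros generate the unit ideal. From
  these, the homeomorphism is obtained once and for all in the locale \<open>zero_set_ring\<close>. The delicate
  point is \<open>zultrafilter_of_maximal\<close>: that the intersection of two zero sets of elements of \<open>M\<close> is again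
  one is shown with generic real linear combinations, using that closed discrete sets are countable.

  For entire functions, the second property is the Weierstrass product theorem. The third one,
  \<open>bezout_entire\<close>, is obtained by solving \<open>s f + t g = 1\<close> on discs, where \<open>f\<close> has finitely many zeros, and
  by patching these solutions in the manner of a Mittag-Leffler argument. For real analytic functions,
  the third property is elementary because \<open>f\<^sup>2 + g\<^sup>2\<close> has no zero, and the functions for the
  second one are restrictions of entire functions.

  The entire functions with real Taylor coefficients need one more idea. Their zero sets are symmetric
  under conjugation, so a fixed maximal ideal corresponds to a point of the closed upper half-plane and
  not to a point of the plane. But the space of discrete z-ultrafilters depends only on the family of
  closed discrete sets, that is of the sets with finitely many points in every disc. A bijection
  between the plane and the half-plane that preserves the absolute value therefore identifies the two
  spaces of ultrafilters, so the structure space is homeomorphic to that of the whole plane, although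
  not by sending the ideal of a point to the ultrafilter of this point.
\<close>

section \<open>Closed discrete sets and discrete z-ultrafilters\<close>

lemma closed_discrete_iff_no_limpt:
  fixes D :: "'a::topological_space set"
  shows "closed D \<and> discrete D \<longleftrightarrow> (\<forall>x. \<not> x islimpt D)"
  by (simp add: closed_discrete_iff islimpt_iff_eventually)

text \<open>In a space with the Heine-Borel property, only the bounded sets matter for deciding which sets are
  closed and discrete. In particular, a bijection preserving the norm preserves these sets, however
  discontinuous it may be.\<close>

lemma closed_discrete_iff_finite_cball:
  fixes D :: "'a::{real_normed_vector, heine_borel} set"
  shows "closed D \<and> discrete D \<longleftrightarrow> (\<forall>r. finite (D \<inter> cball 0 r))"
proof
  assume "closed D \<and> discrete D"
  then have "finite (cball 0 r \<inter> D)" for r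
    unfolding closed_discrete_iff_no_limpt by (intro finite_not_islimpt_in_compact) auto
  then show "\<forall>r. finite (D \<inter> cball 0 r)" by (simp add: Int_commute)
next
  assume fin: "\<forall>r. finite (D \<inter> cball 0 r)"
  show "closed D \<and> discrete D"
    unfolding closed_discrete_iff_no_limpt
  proof (intro allI notI)
    fix x assume "x islimpt D"
    then have "infinite (D \<inter> ball x 1)"
      using islimpt_eq_infinite_ball[of x D] by simp
    moreover have "D \<inter> ball x 1 \<subseteq> D \<inter> cball 0 (norm x + 1)"
      by (auto simp: dist_norm) (smt (verit) norm_triangle_sub norm_minus_commute)
    ultimately show False using fin finite_subset by blast
  qed
qed

lemma closed_discrete_imp_countable:
  fixes D :: "'a::{real_normed_vector, heine_borel} set"
  assumes "closed D \<and> discrete D"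
  shows "countable D"
proof -
  have "D = (\<Union>n::nat. D \<inter> cball 0 (real n))" by (auto simp: real_arch_simple)
  moreover have "countable (\<Union>n::nat. D \<inter> cball 0 (real n))"
    using assms unfolding closed_discrete_iff_finite_cball by (intro countable_UN) (auto intro: countable_finite)
  ultimately show ?thesis by simp
qed

lemma UNIV_in_zultrafilter:
  assumes "discrete_zultrafilter p"
  shows "UNIV \<in> p"
proof (rule ccontr)
  assume "UNIV \<notin> p"
  then obtain D where "D \<in> p" "D \<inter> UNIV = {}"
    using discrete_zultrafilter_meets[OF assms, of UNIV] by (auto simp: discrete_zsets_def)
  then show False
    using assms by (auto simp: discrete_zultrafilter_def discrete_zfilter_def)
qed

lemma continuous_map_into_base:
  assumes Y: "openin Y = arbitrary union_of P"
    and h: "\<And>x. x \<in> topspace X \<Longrightarrow> h x \<in> topspace Y"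
    and P: "\<And>U. P U \<Longrightarrow> openin X {x \<in> topspace X. h x \<in> U}"
  shows "continuous_map X Y h"
  unfolding continuous_map_def
proof (intro conjI allI impI)
  show "h \<in> topspace X \<rightarrow> topspace Y" using h by auto
  fix U assume "openin Y U"
  then obtain \<U> where \<U>: "\<And>V. V \<in> \<U> \<Longrightarrow> P V" "U = \<Union>\<U>"
    unfolding Y union_of_def arbitrary_def by auto
  have "{x \<in> topspace X. h x \<in> U} = (\<Union>V\<in>\<U>. {x \<in> topspace X. h x \<in> V})"
    using \<U>(2) by auto
  then show "openin X {x \<in> topspace X. h x \<in> U}"
    using P[OF \<U>(1)] by (auto intro: openin_Union)
qed


section \<open>Rings of functions that are determined by their zero sets\<close>

text \<open>What the three rings have in common. The map \<open>\<phi>\<close> parametrises the points at which zeros are counted: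
  it is the identity for the entire and for the real analytic functions, but the zeros of an entire
  function with real Taylor coefficients are symmetric under conjugation, so there the zeros are
  counted only on a set of representatives, reindexed by the whole plane.\<close>

locale zero_set_ring =
  fixes A :: "('a \<Rightarrow> 'k::real_normed_field) set" and \<phi> :: "'x::{real_normed_vector, heine_borel} \<Rightarrow> 'a"
  assumes cring_A: "cring (function_ring A)"
    and const_mem: "(\<lambda>_. of_real c) \<in> A"
    and zeros_closed_discrete:
      "f \<in> A \<Longrightarrow> f \<noteq> (\<lambda>_. 0) \<Longrightarrow> closed {x. f (\<phi> x) = 0} \<and> discrete {x. f (\<phi> x) = 0}"
    and prescribed_zeros: "closed D \<Longrightarrow> discrete D \<Longrightarrow> \<exists>f\<in>A. {x. f (\<phi> x) = 0} = D"
    and bezout: "f \<in> A \<Longrightarrow> g \<in> A \<Longrightarrow> (\<And>x. f (\<phi> x) = 0 \<Longrightarrow> g (\<phi> x) \<noteq> 0) \<Longrightarrow>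
      \<exists>s\<in>A. \<exists>t\<in>A. \<forall>y. s y * f y + t y * g y = 1"
begin

definition zeros :: "('a \<Rightarrow> 'k) \<Rightarrow> 'x set"
  where "zeros f = {x. f (\<phi> x) = 0}"

sublocale R: cring "function_ring A"
  by (rule cring_A)

lemma mult_mem: "f \<in> A \<Longrightarrow> g \<in> A \<Longrightarrow> (\<lambda>y. f y * g y) \<in> A"
  using R.m_closed[of f g] by (simp add: function_ring_def)

lemma zero_mem: "(\<lambda>y. 0) \<in> A"
  using R.zero_closed by (simp add: function_ring_def)

lemma zeros_zset: "f \<in> A \<Longrightarrow> zeros f \<in> discrete_zsets"
  using zeros_closed_discrete[of f] by (cases "f = (\<lambda>_. 0)") (auto simp: zeros_def discrete_zsets_def)

lemma ex_zeros_eq: "D \<in> discrete_zsets \<Longrightarrow> \<exists>f\<in>A. zeros f = D"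
  using prescribed_zeros[of D] zero_mem by (auto simp: zeros_def discrete_zsets_def)

text \<open>Maximal ideals of a ring of functions in pointwise terms; the last fact is the maximality of \<open>M\<close>,
  applied to the ideal that \<open>M\<close> and \<open>f\<close> generate.\<close>

lemma
  assumes "maximalideal M (function_ring A)"
  shows maximal_subset: "M \<subseteq> A"
    and maximal_zero: "(\<lambda>_. 0) \<in> M"
    and maximal_add: "f \<in> M \<Longrightarrow> g \<in> M \<Longrightarrow> (\<lambda>y. f y + g y) \<in> M"
    and maximal_mult: "f \<in> M \<Longrightarrow> a \<in> A \<Longrightarrow> (\<lambda>y. a y * f y) \<in> M"
    and maximal_no_one: "(\<lambda>_. 1) \<notin> M"
    and maximal_ex: "f \<in> A \<Longrightarrow> f \<notin> M \<Longrightarrow> \<exists>m\<in>M. \<exists>a\<in>A. \<forall>y. m y + a y * f y = 1"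
proof -
  interpret M: maximalideal M "function_ring A" by fact
  show "M \<subseteq> A" using M.a_subset by (simp add: function_ring_def)
  show "(\<lambda>_. 0) \<in> M" using M.zero_closed by (simp add: function_ring_def)
  show "f \<in> M \<Longrightarrow> g \<in> M \<Longrightarrow> (\<lambda>y. f y + g y) \<in> M"
    using M.a_closed[of f g] by (simp add: function_ring_def)
  show "f \<in> M \<Longrightarrow> a \<in> A \<Longrightarrow> (\<lambda>y. a y * f y) \<in> M"
    using M.I_l_closed[of f a] by (simp add: function_ring_def)
  show "(\<lambda>_. 1) \<notin> M"
    using M.one_imp_carrier M.I_notcarr by (auto simp: function_ring_def)
  assume f: "f \<in> A" "f \<notin> M"
  let ?F = "PIdl\<^bsub>function_ring A\<^esub> f"
  have fc: "f \<in> carrier (function_ring A)" using f by (simp add: function_ring_def)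
  have I: "ideal (M <+>\<^bsub>function_ring A\<^esub> ?F) (function_ring A)"
    by (rule R.add_ideals[OF M.is_ideal R.cgenideal_ideal[OF fc]])
  have "M \<subseteq> M <+>\<^bsub>function_ring A\<^esub> ?F"
  proof
    fix m assume "m \<in> M"
    moreover have "\<zero>\<^bsub>function_ring A\<^esub> \<in> ?F"
      using R.cgenideal_ideal[OF fc] additive_subgroup.zero_closed ideal.axioms(1) by blast
    ultimately show "m \<in> M <+>\<^bsub>function_ring A\<^esub> ?F"
      unfolding set_add_def' by (force simp: function_ring_def)
  qed
  moreover have "f \<in> M <+>\<^bsub>function_ring A\<^esub> ?F"
    using R.cgenideal_self[OF fc] M.zero_closed unfolding set_add_def' by (force simp: function_ring_def)
  ultimately have "M <+>\<^bsub>function_ring A\<^esub> ?F = A"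
    using M.I_maximal[OF I] ideal.Icarr[OF I] f by (auto simp: function_ring_def)
  moreover have "(\<lambda>_. 1) \<in> A" using R.one_closed by (simp add: function_ring_def)
  ultimately have "(\<lambda>_. 1) \<in> M <+>\<^bsub>function_ring A\<^esub> ?F" by simp
  then obtain m u where "m \<in> M" "u \<in> ?F" and eq: "(\<lambda>_. 1) = (\<lambda>y. m y + u y)"
    unfolding set_add_def' by (auto simp: function_ring_def)
  moreover from \<open>u \<in> ?F\<close> obtain a where "a \<in> A" "u = (\<lambda>y. a y * f y)"
    by (auto simp: cgenideal_def function_ring_def)
  ultimately show "\<exists>m\<in>M. \<exists>a\<in>A. \<forall>y. m y + a y * f y = 1"
    using fun_cong[OF eq] by (intro bexI[of _ m] bexI[of _ a] allI) simp_all
qed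

lemma maximalI:
  assumes sub: "M \<subseteq> A" and zero: "(\<lambda>_. 0) \<in> M"
    and add: "\<And>f g. f \<in> M \<Longrightarrow> g \<in> M \<Longrightarrow> (\<lambda>y. f y + g y) \<in> M"
    and mult: "\<And>f a. f \<in> M \<Longrightarrow> a \<in> A \<Longrightarrow> (\<lambda>y. a y * f y) \<in> M"
    and no_one: "(\<lambda>_. 1) \<notin> M"
    and ex: "\<And>f. f \<in> A \<Longrightarrow> f \<notin> M \<Longrightarrow> \<exists>m\<in>M. \<exists>a\<in>A. \<forall>y. a y * f y + m y = 1"
  shows "maximalideal M (function_ring A)"
proof (rule maximalidealI)
  have ring: "ring (function_ring A)" by (rule R.ring_axioms)
  have neg: "(\<lambda>y. - f y) \<in> M" and inv: "\<ominus>\<^bsub>function_ring A\<^esub> f = (\<lambda>y. - f y)" if "f \<in> M" for f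
  proof -
    show *: "(\<lambda>y. - f y) \<in> M" using mult[OF that const_mem[of "-1"]] by simp
    show "\<ominus>\<^bsub>function_ring A\<^esub> f = (\<lambda>y. - f y)"
      by (rule R.minus_equality) (use * that sub in \<open>auto simp: function_ring_def\<close>)
  qed
  show "ideal M (function_ring A)"
  proof (rule idealI[OF ring])
    show "subgroup M (add_monoid (function_ring A))"
    proof (rule group.subgroupI[OF abelian_group.a_group[OF R.abelian_group_axioms]])
      show "inv\<^bsub>add_monoid (function_ring A)\<^esub> f \<in> M" if "f \<in> M" for f
        using neg[OF that] inv[OF that] by (simp add: a_inv_def)
    qed (use sub zero add in \<open>auto simp: function_ring_def\<close>)
  qed (use mult in \<open>auto simp: function_ring_def mult.commute\<close>)
  show "carrier (function_ring A) \<noteq> M"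
    using no_one R.one_closed by (auto simp: function_ring_def)
  fix J assume J: "ideal J (function_ring A)" "M \<subseteq> J" "J \<subseteq> carrier (function_ring A)"
  show "J = M \<or> J = carrier (function_ring A)"
  proof (rule disjCI)
    assume "J \<noteq> carrier (function_ring A)"
    then have no1: "(\<lambda>_. 1) \<notin> J"
      using ideal.one_imp_carrier[OF J(1)] by (auto simp: function_ring_def)
    show "J = M"
    proof (rule ccontr)
      assume "J \<noteq> M"
      then obtain f where f: "f \<in> J" "f \<notin> M" using J by blast
      then obtain m a where "m \<in> M" "a \<in> A" "\<forall>y. a y * f y + m y = 1"
        using ex[of f] J by (auto simp: function_ring_def)
      moreover from this have "(\<lambda>y. a y * f y) \<in> J"
        using ideal.I_l_closed[OF J(1) f(1), of a] by (simp add: function_ring_def)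
      ultimately have "(\<lambda>y. a y * f y + m y) \<in> J"
        using additive_subgroup.a_closed[OF ideal.axioms(1)[OF J(1)], of "\<lambda>y. a y * f y" m] J
        by (auto simp: function_ring_def)
      with \<open>\<forall>y. a y * f y + m y = 1\<close> no1 show False by simp
    qed
  qed
qed

definition ideal_of :: "'x set set \<Rightarrow> ('a \<Rightarrow> 'k) set"
  where "ideal_of p = {f \<in> A. zeros f \<in> p}"

text \<open>A maximal ideal is determined by the zero sets of its elements: two elements of a proper ideal
  have a common zero by the Bezout property, and a function \<open>f\<close> outside of \<open>M\<close> satisfies \<open>m + a f = 1\<close>
  with \<open>m\<close> in \<open>M\<close>, so that \<open>f\<close> and \<open>m\<close> have no common zero.\<close>

lemma maximal_mem_iff:
  assumes M: "maximalideal M (function_ring A)" and f: "f \<in> A"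
  shows "f \<in> M \<longleftrightarrow> (\<forall>g\<in>M. zeros f \<inter> zeros g \<noteq> {})"
proof
  assume fM: "f \<in> M"
  show "\<forall>g\<in>M. zeros f \<inter> zeros g \<noteq> {}"
  proof (intro ballI notI)
    fix g assume g: "g \<in> M" "zeros f \<inter> zeros g = {}"
    then obtain s t where "s \<in> A" "t \<in> A" "\<forall>y. s y * f y + t y * g y = 1"
      using bezout[OF f, of g] maximal_subset[OF M] by (auto simp: zeros_def)
    moreover have "(\<lambda>y. s y * f y + t y * g y) \<in> M"
      by (intro maximal_add[OF M] maximal_mult[OF M]) fact+
    ultimately show False using maximal_no_one[OF M] by simp
  qed
next
  assume meets: "\<forall>g\<in>M. zeros f \<inter> zeros g \<noteq> {}"
  show "f \<in> M"
  proof (rule ccontr)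
    assume "f \<notin> M"
    then obtain m a where ma: "m \<in> M" "a \<in> A" "\<forall>y. m y + a y * f y = 1"
      using maximal_ex[OF M f] by blast
    then obtain x where "f (\<phi> x) = 0" "m (\<phi> x) = 0" using meets by (auto simp: zeros_def)
    then show False using ma(3)[rule_format, of "\<phi> x"] by simp
  qed
qed

text \<open>By \<open>maximal_mem_iff\<close>, the zero sets of \<open>M\<close> are exactly the members of \<^const>\<open>discrete_zsets\<close> that meet all of
  them. This gives closure under supersets and maximality. Closure under intersections asks that
  \<open>f\<close>, \<open>g\<close> and \<open>k\<close> in \<open>M\<close> have a common zero, which the Bezout property for pairs does not say
  directly; it is reduced to the pair \<open>f + c g\<close>, \<open>k\<close> for a suitable real constant \<open>c\<close>.\<close>

lemma zultrafilter_of_maximal: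
  assumes M: "maximalideal M (function_ring A)"
  shows "discrete_zultrafilter (zeros ` M)"
proof -
  note mem = maximal_mem_iff[OF M] and sub = maximal_subset[OF M, THEN subsetD]
  have in_image: "D \<in> zeros ` M \<longleftrightarrow> D \<in> discrete_zsets \<and> (\<forall>g\<in>M. D \<inter> zeros g \<noteq> {})" for D
    using mem sub zeros_zset ex_zeros_eq by (smt (verit, best) image_iff)
  have Int: "zeros f \<inter> zeros g \<in> zeros ` M" if fg: "f \<in> M" "g \<in> M" "f \<noteq> (\<lambda>_. 0)" for f g
  proof -
    have "zeros f \<inter> zeros g \<inter> zeros k \<noteq> {}" if k: "k \<in> M" "k \<noteq> (\<lambda>_. 0)" for k
    proof -
      \<comment> \<open>At a point of \<open>zeros k\<close> where \<open>f\<close> and \<open>g\<close> do not both vanish, \<open>f + c g\<close> vanishes for at most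
        one \<open>c\<close>. As \<open>zeros k\<close> is countable, some real \<open>c\<close> avoids all of these values.\<close>
      have "countable (zeros k)"
        using zeros_closed_discrete[of k] k sub closed_discrete_imp_countable by (auto simp: zeros_def)
      then have "countable ((\<lambda>x. - f (\<phi> x) / g (\<phi> x)) ` zeros k)" by simp
      moreover have "uncountable (of_real ` (UNIV :: real set) :: 'k set)"
        using uncountable_UNIV_real by (metis countable_image_inj_eq inj_of_real)
      ultimately obtain c where c: "(of_real c :: 'k) \<notin> (\<lambda>x. - f (\<phi> x) / g (\<phi> x)) ` zeros k"
        by (meson countable_subset image_subsetI)
      define h where "h = (\<lambda>y. f y + of_real c * g y)"
      have "h \<in> M"
        unfolding h_def by (intro maximal_add[OF M] maximal_mult[OF M] const_mem fg)
      then obtain x where x: "h (\<phi> x) = 0" "x \<in> zeros k"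
        using mem[of h] sub k by (auto simp: zeros_def)
      have "g (\<phi> x) = 0"
      proof (rule ccontr)
        assume "g (\<phi> x) \<noteq> 0"
        moreover have "of_real c * g (\<phi> x) = - f (\<phi> x)"
          using x(1) by (simp add: h_def add_eq_0_iff)
        ultimately have "of_real c = - f (\<phi> x) / g (\<phi> x)" by (rule eq_divide_imp)
        with c x(2) show False by blast
      qed
      with x show ?thesis by (auto simp: h_def zeros_def)
    qed
    note nonzero = this
    have "zeros f \<inter> zeros g \<inter> zeros k \<noteq> {}" if k: "k \<in> M" for k
    proof (cases "k = (\<lambda>_. 0)")
      case True
      then have "zeros f \<inter> zeros g \<inter> zeros k = zeros f \<inter> zeros g \<inter> zeros f" by (auto simp: zeros_def)
      then show ?thesis using nonzero[OF fg(1,3)] by simp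
    qed (use nonzero k in blast)
    then show ?thesis
      unfolding in_image using discrete_zsets_Int zeros_zset sub fg by blast
  qed
  have filt: "discrete_zfilter (zeros ` M)"
    unfolding discrete_zfilter_def
  proof (intro conjI ballI impI)
    show "zeros ` M \<subseteq> discrete_zsets" using in_image by blast
    show "{} \<notin> zeros ` M" using in_image[of "{}"] maximal_zero[OF M] by auto
    show "D \<inter> E \<in> zeros ` M" if "D \<in> zeros ` M" "E \<in> zeros ` M" for D E
    proof -
      from that obtain f g where fg: "f \<in> M" "g \<in> M" "D = zeros f" "E = zeros g" by blast
      show ?thesis
      proof (cases "f = (\<lambda>_. 0)")
        case True
        then have "D = UNIV" using fg by (simp add: zeros_def)
        then show ?thesis using that by simp
      qed (use Int fg in blast)
    qed
    show "E \<in> zeros ` M" if "D \<in> zeros ` M" "E \<in> discrete_zsets" "D \<subseteq> E" for D E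
      using that unfolding in_image by blast
  qed
  moreover have "\<G> = zeros ` M" if \<G>: "discrete_zfilter \<G>" "zeros ` M \<subseteq> \<G>" for \<G>
  proof
    show "\<G> \<subseteq> zeros ` M"
    proof
      fix D assume D: "D \<in> \<G>"
      have "D \<inter> zeros g \<noteq> {}" if "g \<in> M" for g
      proof -
        have "D \<inter> zeros g \<in> \<G>" "{} \<notin> \<G>"
          using \<G> D that by (auto simp: discrete_zfilter_def)
        then show ?thesis by metis
      qed
      moreover have "D \<in> discrete_zsets" using D \<G> by (auto simp: discrete_zfilter_def)
      ultimately show "D \<in> zeros ` M" by (simp add: in_image)
    qed
  qed fact
  ultimately show ?thesis by (auto simp: discrete_zultrafilter_def)
qed

text \<open>For maximality: if the zero set of \<open>f\<close> is not in the ultrafilter \<open>p\<close>, it is disjoint from some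
  member of \<open>p\<close>. That member is the zero set of some \<open>d\<close> in the ideal, and the Bezout property for
  \<open>f\<close> and \<open>d\<close> produces the unit.\<close>

lemma maximal_ideal_of_zultrafilter:
  assumes p: "discrete_zultrafilter p"
  shows "maximalideal (ideal_of p) (function_ring A)"
proof (rule maximalI)
  have ne: "{} \<notin> p" and Int: "\<And>D E. D \<in> p \<Longrightarrow> E \<in> p \<Longrightarrow> D \<inter> E \<in> p" and z: "p \<subseteq> discrete_zsets"
    and up: "\<And>D E. D \<in> p \<Longrightarrow> E \<in> discrete_zsets \<Longrightarrow> D \<subseteq> E \<Longrightarrow> E \<in> p"
    using p by (auto simp: discrete_zultrafilter_def discrete_zfilter_def)
  show "ideal_of p \<subseteq> A" by (auto simp: ideal_of_def)
  show "(\<lambda>_. 0) \<in> ideal_of p"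
    using UNIV_in_zultrafilter[OF p] zero_mem by (simp add: ideal_of_def zeros_def)
  show "(\<lambda>_. 1) \<notin> ideal_of p" using ne by (simp add: ideal_of_def zeros_def)
  show "(\<lambda>y. f y + g y) \<in> ideal_of p" if "f \<in> ideal_of p" "g \<in> ideal_of p" for f g
  proof -
    have "(\<lambda>y. f y + g y) \<in> A"
      using that R.a_closed[of f g] by (simp add: ideal_of_def function_ring_def)
    moreover have "zeros f \<inter> zeros g \<in> p" using that Int by (simp add: ideal_of_def)
    moreover have "zeros f \<inter> zeros g \<subseteq> zeros (\<lambda>y. f y + g y)" by (auto simp: zeros_def)
    ultimately show ?thesis using up zeros_zset by (auto simp: ideal_of_def)
  qed
  show "(\<lambda>y. a y * f y) \<in> ideal_of p" if "f \<in> ideal_of p" "a \<in> A" for f a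
  proof -
    have "(\<lambda>y. a y * f y) \<in> A" using that mult_mem by (simp add: ideal_of_def)
    moreover have "zeros f \<in> p" using that by (simp add: ideal_of_def)
    moreover have "zeros f \<subseteq> zeros (\<lambda>y. a y * f y)" by (auto simp: zeros_def)
    ultimately show ?thesis using up zeros_zset by (auto simp: ideal_of_def)
  qed
  show "\<exists>m\<in>ideal_of p. \<exists>a\<in>A. \<forall>y. a y * f y + m y = 1" if f: "f \<in> A" "f \<notin> ideal_of p" for f
  proof -
    obtain D where D: "D \<in> p" "D \<inter> zeros f = {}"
      using discrete_zultrafilter_meets[OF p zeros_zset[OF f(1)]] f by (auto simp: ideal_of_def)
    then obtain d where d: "d \<in> A" "zeros d = D" using ex_zeros_eq z by blast
    then obtain s t where st: "s \<in> A" "t \<in> A" "\<forall>y. s y * f y + t y * d y = 1"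
      using bezout[OF f(1) d(1)] D(2) by (auto simp: zeros_def)
    have "zeros d \<subseteq> zeros (\<lambda>y. t y * d y)" by (auto simp: zeros_def)
    then have "(\<lambda>y. t y * d y) \<in> ideal_of p"
      using up[OF D(1)] d st mult_mem zeros_zset by (simp add: ideal_of_def)
    with st show ?thesis by (intro bexI[of _ "\<lambda>y. t y * d y"] bexI[of _ s])
  qed
qed

text \<open>The bijection \<open>M \<mapsto> zeros ` M\<close> is a homeomorphism because \<open>f\<close> lies in \<open>M\<close> iff the zero set of \<open>f\<close>
  lies in \<open>zeros ` M\<close>, so basic closed sets correspond to basic closed sets.\<close>

theorem structure_space_homeomorphic_theta:
  "structure_space (function_ring A) homeomorphic_space (theta_space :: 'x set set topology)"
proof -
  have max: "M \<in> maximal_ideals (function_ring A) \<longleftrightarrow> maximalideal M (function_ring A)" for M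
    by (simp add: maximal_ideals_def)
  have mem: "f \<in> M \<longleftrightarrow> f \<in> A \<and> zeros f \<in> zeros ` M" if M: "maximalideal M (function_ring A)" for f M
    using maximal_mem_iff[OF M] maximal_subset[OF M] by (smt (verit) image_iff subsetD)
  have "homeomorphic_maps (structure_space (function_ring A)) (theta_space :: 'x set set topology)
     (\<lambda>M. zeros ` M) ideal_of"
    unfolding homeomorphic_maps_def topspace_theta_space topspace_structure_space[OF cring_A]
  proof (intro conjI ballI)
    show "continuous_map (structure_space (function_ring A)) (theta_space :: 'x set set topology)
       (\<lambda>M. zeros ` M)"
    proof (rule continuous_map_into_base[OF openin_theta_space];
        (unfold topspace_theta_space topspace_structure_space[OF cring_A])?)
      show "M \<in> maximal_ideals (function_ring A) \<Longrightarrow> zeros ` M \<in> theta" for M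
        using zultrafilter_of_maximal by (simp add: max theta_def)
      fix U :: "'x set set set" assume "\<exists>D. closed D \<and> discrete D \<and> U = theta - theta_closure D"
      then obtain D where D: "closed D" "discrete D" "U = theta - theta_closure D" by blast
      obtain f where f: "f \<in> A" "zeros f = D" using prescribed_zeros[OF D(1,2)] by (auto simp: zeros_def)
      have "{M \<in> maximal_ideals (function_ring A). zeros ` M \<in> U}
          = maximal_ideals (function_ring A) - maximal_ideals_containing (function_ring A) f"
      proof -
        have "zeros ` M \<in> U \<longleftrightarrow> f \<notin> M" if M: "M \<in> maximal_ideals (function_ring A)" for M
        proof -
          have "f \<in> M \<longleftrightarrow> D \<in> zeros ` M" using mem[of M f] M f by (simp add: max)
          moreover have "zeros ` M \<in> theta" using M zultrafilter_of_maximal by (simp add: max theta_def)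
          ultimately show ?thesis by (simp add: D(3) theta_closure_def)
        qed
        then show ?thesis unfolding maximal_ideals_containing_def by blast
      qed
      moreover have "f \<in> carrier (function_ring A)" using f by (simp add: function_ring_def)
      ultimately show "openin (structure_space (function_ring A))
          {M \<in> maximal_ideals (function_ring A). zeros ` M \<in> U}"
        unfolding openin_structure_space[OF cring_A] by (intro arbitrary_union_of_inc bexI)
    qed
    show "continuous_map (theta_space :: 'x set set topology) (structure_space (function_ring A)) ideal_of"
    proof (rule continuous_map_into_base[OF openin_structure_space[OF cring_A]];
        (unfold topspace_theta_space topspace_structure_space[OF cring_A])?)
      show "p \<in> theta \<Longrightarrow> ideal_of p \<in> maximal_ideals (function_ring A)" for p
        using maximal_ideal_of_zultrafilter by (simp add: max theta_def)
      fix U assume "\<exists>f\<in>carrier (function_ring A).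
        U = maximal_ideals (function_ring A) - maximal_ideals_containing (function_ring A) f"
      then obtain f where f: "f \<in> A"
        and U: "U = maximal_ideals (function_ring A) - maximal_ideals_containing (function_ring A) f"
        by (auto simp: function_ring_def)
      have eq: "{p \<in> theta. ideal_of p \<in> U} = theta - theta_closure (zeros f)"
        using maximal_ideal_of_zultrafilter f
        by (auto simp: U max theta_def theta_closure_def maximal_ideals_containing_def ideal_of_def)
      show "openin (theta_space :: 'x set set topology) {p \<in> theta. ideal_of p \<in> U}"
      proof (cases "f = (\<lambda>_. 0)")
        case True
        \<comment> \<open>The whole space is no closed discrete set, so the zero function does not give a basic open set;
          but the open set that it gives is empty.\<close>
        then have "{p \<in> theta. ideal_of p \<in> U} = {}"
          unfolding eq using UNIV_in_zultrafilter by (auto simp: zeros_def theta_def theta_closure_def)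
        then show ?thesis by (simp only: openin_empty)
      next
        case False
        then have "closed (zeros f) \<and> discrete (zeros f)"
          using zeros_closed_discrete f by (simp add: zeros_def)
        then show ?thesis
          unfolding eq openin_theta_space by (intro arbitrary_union_of_inc) blast
      qed
    qed
    fix M assume "M \<in> maximal_ideals (function_ring A)"
    then show "ideal_of (zeros ` M) = M" unfolding ideal_of_def max using mem by blast
  next
    fix p :: "'x set set" assume "p \<in> theta"
    then have "p \<subseteq> discrete_zsets"
      by (auto simp: theta_def discrete_zultrafilter_def discrete_zfilter_def)
    then have "D \<in> zeros ` ideal_of p" if "D \<in> p" for D
      using ex_zeros_eq[of D] that by (auto simp: ideal_of_def)
    then show "zeros ` ideal_of p = p" by (auto simp: ideal_of_def)
  qed
  then show ?thesis by (auto simp: homeomorphic_space_def)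
qed

end


section \<open>The Bezout property of entire functions\<close>

lemma finite_zeros_entire:
  assumes f: "f holomorphic_on UNIV" and "f \<noteq> (\<lambda>_. 0)"
  shows "finite {z \<in> cball 0 r. f z = 0}"
proof (cases "f constant_on UNIV")
  case True
  then have "{z \<in> cball 0 r. f z = 0} = {}" using assms(2) by (auto simp: constant_on_def)
  then show ?thesis by (simp only: finite.emptyI)
qed (rule holomorphic_compact_finite_zeros[OF f], auto)

definition bezout_on :: "complex set \<Rightarrow> (complex \<Rightarrow> complex) \<Rightarrow> (complex \<Rightarrow> complex) \<Rightarrow> bool"
  where "bezout_on S f g \<longleftrightarrow> (\<exists>s t. s holomorphic_on S \<and> t holomorphic_on S \<and>
    (\<forall>z\<in>S. s z * f z + t z * g z = 1))"

text \<open>The correction \<open>s f + t g = (s - c g) f + (t + c f) g\<close> with \<open>c = s a / g a\<close> makes the coefficient of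
  \<open>f\<close> vanish at \<open>a\<close>, so that a factor \<open>z - a\<close> can be moved from it to \<open>f\<close>.\<close>

lemma bezout_on_mult_root:
  assumes S: "open S" and f: "f holomorphic_on S" and g: "g holomorphic_on S"
    and ga: "g a \<noteq> 0" and b: "bezout_on S f g"
  shows "bezout_on S (\<lambda>z. (z - a) * f z) g"
proof -
  obtain s t where st: "s holomorphic_on S" "t holomorphic_on S"
    and eq: "\<And>z. z \<in> S \<Longrightarrow> s z * f z + t z * g z = 1"
    using b unfolding bezout_on_def by blast
  define c where "c = s a / g a"
  define u where "u = (\<lambda>z. s z - c * g z)"
  define s' where "s' = (\<lambda>z. if z = a then deriv u a else (u z - u a) / (z - a))"
  have ua: "u a = 0"
    using ga by (simp add: u_def c_def)
  have "u holomorphic_on S"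
    unfolding u_def by (intro holomorphic_intros st g)
  then have "s' holomorphic_on S"
    unfolding s'_def using S by (rule pole_lemma_open)
  moreover have "(\<lambda>z. t z + c * f z) holomorphic_on S"
    by (intro holomorphic_intros st f)
  moreover have "s' z * ((z - a) * f z) + (t z + c * f z) * g z = 1" if "z \<in> S" for z
  proof -
    have "s' z * (z - a) = u z"
      by (simp add: s'_def ua)
    then have "s' z * ((z - a) * f z) + (t z + c * f z) * g z = u z * f z + (t z + c * f z) * g z"
      by (metis mult.assoc)
    also have "\<dots> = s z * f z + t z * g z"
      by (simp add: u_def algebra_simps)
    finally show ?thesis using eq[OF that] by simp
  qed
  ultimately show ?thesis unfolding bezout_on_def by blast
qed

lemma bezout_on_mult_root_power:
  assumes S: "open S" and f: "f holomorphic_on S" and g: "g holomorphic_on S"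
    and ga: "g a \<noteq> 0" and b: "bezout_on S f g"
  shows "bezout_on S (\<lambda>z. (z - a) ^ m * f z) g"
proof (induction m)
  case (Suc m)
  have "bezout_on S (\<lambda>z. (z - a) * ((z - a) ^ m * f z)) g"
    by (rule bezout_on_mult_root[OF S _ g ga Suc.IH]) (intro holomorphic_intros f)
  then show ?case by (simp add: mult.assoc)
qed (use b in simp)

text \<open>The local factorisation at \<open>a\<close> is extended by \<open>f z / (z - a) ^ m\<close>.\<close>

lemma holomorphic_factor_out_zero:
  assumes S: "open S" "connected S" and f: "f holomorphic_on S" and a: "a \<in> S" "f a = 0"
    and w: "w \<in> S" "f w \<noteq> 0"
  obtains h m where "h holomorphic_on S" "h a \<noteq> 0" "\<And>z. z \<in> S \<Longrightarrow> f z = (z - a) ^ m * h z"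
proof -
  have "\<not> f constant_on S" using a w unfolding constant_on_def by metis
  then obtain g r m where m: "0 < m" "0 < r" "ball a r \<subseteq> S"
    and g: "g holomorphic_on ball a r" "\<And>z. z \<in> ball a r \<Longrightarrow> f z = (z - a) ^ m * g z"
      "\<And>z. z \<in> ball a r \<Longrightarrow> g z \<noteq> 0"
    using holomorphic_factor_zero_nonconstant[OF f S a] by metis
  define h where "h = (\<lambda>z. if z = a then g a else f z / (z - a) ^ m)"
  have hg: "h z = g z" if "z \<in> ball a r" for z
    using g(2)[OF that] by (simp add: h_def)
  have "h holomorphic_on (S - {a})"
  proof (rule holomorphic_transform)
    show "(\<lambda>z. f z / (z - a) ^ m) holomorphic_on (S - {a})"
      by (intro holomorphic_intros holomorphic_on_subset[OF f]) auto
  qed (simp add: h_def)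
  moreover have "h holomorphic_on ball a r"
    by (rule holomorphic_transform[OF g(1)]) (simp add: hg)
  moreover have "S - {a} \<union> ball a r = S" using a m by auto
  ultimately have "h holomorphic_on S"
    using holomorphic_on_Un[of h "S - {a}" "ball a r"] S by auto
  moreover have "h a \<noteq> 0" using g(3)[of a] m by (simp add: h_def)
  moreover have "f z = (z - a) ^ m * h z" if "z \<in> S" for z
    using a m by (auto simp: h_def)
  ultimately show ?thesis by (rule that)
qed

text \<open>Without zeros, \<open>1 / f\<close> solves the equation; the zeros of \<open>f\<close> are then put back one at a time, with
  their multiplicities, by \<open>bezout_on_mult_root_power\<close>.\<close>

lemma bezout_on_finite_zeros:
  assumes S: "open S" "connected S" "infinite S" and g: "g holomorphic_on S"
    and f: "f holomorphic_on S" "finite {z \<in> S. f z = 0}"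
    and no: "\<And>z. z \<in> S \<Longrightarrow> f z = 0 \<Longrightarrow> g z \<noteq> 0"
  shows "bezout_on S f g"
  using f no
proof (induction "card {z \<in> S. f z = 0}" arbitrary: f)
  case 0
  then have "\<forall>z\<in>S. f z \<noteq> 0" by auto
  with 0 have "(\<lambda>z. inverse (f z)) holomorphic_on S" by (intro holomorphic_intros) auto
  then show ?case
    unfolding bezout_on_def using \<open>\<forall>z\<in>S. f z \<noteq> 0\<close>
    by (intro exI[of _ "\<lambda>z. inverse (f z)"] exI[of _ "\<lambda>z. 0"]) auto
next
  case (Suc n)
  then obtain a where a: "a \<in> S" "f a = 0"
    by (metis (mono_tags, lifting) card.empty empty_Collect_eq nat.distinct(1))
  obtain w where w: "w \<in> S" "f w \<noteq> 0"
    using Suc.prems(2) S(3) by (metis (mono_tags, lifting) Collect_cong Collect_mem_eq)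
  obtain h m where h: "h holomorphic_on S" "h a \<noteq> 0"
    and fh: "\<And>z. z \<in> S \<Longrightarrow> f z = (z - a) ^ m * h z"
    using holomorphic_factor_out_zero[OF S(1,2) Suc.prems(1) a w] by blast
  have "m \<noteq> 0" using fh[OF a(1)] a h by (metis power_0 mult_1)
  then have Z: "{z \<in> S. h z = 0} = {z \<in> S. f z = 0} - {a}"
    using fh h by auto
  have "bezout_on S h g"
  proof (rule Suc.hyps(1))
    show "n = card {z \<in> S. h z = 0}" using Suc.hyps(2) Suc.prems(2) a by (simp add: Z)
    show "finite {z \<in> S. h z = 0}" using Suc.prems(2) by (simp add: Z)
    show "g z \<noteq> 0" if "z \<in> S" "h z = 0" for z using Suc.prems(3) fh that by simp
  qed (rule h)
  then have "bezout_on S (\<lambda>z. (z - a) ^ m * h z) g"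
    using bezout_on_mult_root_power S h g Suc.prems(3)[OF a] by blast
  then show ?case using fh by (simp add: bezout_on_def)
qed

text \<open>The functions are holomorphic on growing discs only; the telescoping series of their differences
  converges uniformly on every disc, and there all but finitely many of the functions are
  holomorphic.\<close>

lemma holomorphic_limit_of_geometric_steps:
  fixes F :: "nat \<Rightarrow> complex \<Rightarrow> complex"
  assumes hol: "\<And>n. F n holomorphic_on ball 0 (real n + 1)"
    and step: "\<And>n z. norm z \<le> n \<Longrightarrow> norm (F (Suc n) z - F n z) \<le> (1/2) ^ n"
  obtains G where "G holomorphic_on UNIV" "\<And>z. (\<lambda>n. F n z) \<longlonglongrightarrow> G z"
proof -
  define G where "G = (\<lambda>z. lim (\<lambda>n. F n z))"
  have unif: "uniform_limit (cball 0 N) (\<lambda>n. F (n + N)) G sequentially" for N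
  proof -
    have "uniformly_convergent_on (cball 0 N) (\<lambda>n z. \<Sum>i<n. F (Suc i + N) z - F (i + N) z)"
    proof (rule Weierstrass_m_test')
      fix n :: nat and z :: complex assume "z \<in> cball 0 (real N)"
      then have "norm (F (Suc (n + N)) z - F (n + N) z) \<le> (1/2) ^ (n + N)"
        by (intro step) auto
      also have "\<dots> \<le> (1/2) ^ n" by (simp add: power_decreasing)
      finally show "norm (F (Suc n + N) z - F (n + N) z) \<le> (1/2) ^ n" by simp
    qed (simp add: summable_geometric)
    moreover have "(\<Sum>i<n. F (Suc i + N) z - F (i + N) z) = F (n + N) z - F N z" for n z
      by (induction n) auto
    ultimately obtain l where "uniform_limit (cball 0 N) (\<lambda>n z. F (n + N) z - F N z) l sequentially"
      by (auto simp: uniformly_convergent_on_def)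
    have l: "uniform_limit (cball 0 N) (\<lambda>n z. F (n + N) z) (\<lambda>z. l z + F N z) sequentially"
      using uniform_limit_add[OF \<open>uniform_limit _ _ l _\<close>, of "\<lambda>n. F N" "F N"]
      by (simp add: uniform_limit_const)
    moreover have "G z = l z + F N z" if "z \<in> cball 0 N" for z
      unfolding G_def
      by (rule limI, rule LIMSEQ_offset[of _ N], rule tendsto_uniform_limitI[OF l that])
    ultimately show ?thesis
      by (subst uniform_limit_cong'[where g = "\<lambda>n z. F (n + N) z" and i = "\<lambda>z. l z + F N z"]) auto
  qed
  have "G holomorphic_on ball 0 N" for N :: nat
  proof (rule holomorphic_uniform_limit[OF always_eventually unif], rule allI)
    fix n
    have "F (n + N) holomorphic_on cball 0 N"
      by (rule holomorphic_on_subset[OF hol]) auto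
    then show "continuous_on (cball 0 N) (F (n + N)) \<and> F (n + N) holomorphic_on ball 0 N"
      by (meson ball_subset_cball holomorphic_on_imp_continuous_on holomorphic_on_subset)
  qed auto
  moreover have "\<exists>N::nat. z \<in> ball 0 (real N)" for z :: complex
    using reals_Archimedean2[of "norm z"] by auto
  ultimately have "G holomorphic_on UNIV"
    by (metis at_within_open holomorphic_on_def open_UNIV open_ball UNIV_I)
  moreover have "(\<lambda>n. F n z) \<longlonglongrightarrow> G z" for z
  proof -
    obtain N :: nat where "norm z \<le> N" using real_arch_simple by blast
    then show ?thesis
      by (rule_tac LIMSEQ_offset[of _ N], rule_tac tendsto_uniform_limitI[OF unif]) simp
  qed
  ultimately show ?thesis by (rule that)
qed

lemma holomorphic_ball_entire_approximation:
  assumes e: "e holomorphic_on ball 0 R" and r: "r < R" and \<epsilon>: "\<epsilon> > 0"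
  obtains q where "q holomorphic_on UNIV" "\<And>z. z \<in> cball 0 r \<Longrightarrow> norm (e z - q z) < \<epsilon>"
proof -
  define c where "c = (\<lambda>n. (deriv ^^ n) e 0 / fact n)"
  have sums: "(\<lambda>n. c n * z ^ n) sums e z" if "z \<in> ball 0 R" for z
    using holomorphic_power_series[OF e that] by (simp add: c_def)
  have "ereal r < conv_radius c"
  proof (cases "r \<ge> 0")
    case True
    have "norm (of_real ((r + R) / 2) :: complex) \<le> conv_radius c"
      using r True
      by (intro conv_radius_geI sums_summable[OF sums]) (simp add: del: of_real_add of_real_divide)
    then show ?thesis using r True
      by (simp only: norm_of_real) (erule less_le_trans[rotated], simp)
  next
    case False
    then show ?thesis using less_le_trans[of "ereal r" 0 "conv_radius c"] conv_radius_nonneg[of c] by simp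
  qed
  then have "uniform_limit (cball 0 r) (\<lambda>n z. \<Sum>i<n. c i * (z - 0) ^ i) (\<lambda>z. \<Sum>i. c i * (z - 0) ^ i)
      sequentially"
    by (rule powser_uniform_limit)
  then have "\<forall>\<^sub>F n in sequentially. \<forall>z\<in>cball 0 r.
      dist (\<Sum>i<n. c i * (z - 0) ^ i) (\<Sum>i. c i * (z - 0) ^ i) < \<epsilon>"
    using \<epsilon> uniform_limitD by blast
  then obtain n where n: "\<And>z. z \<in> cball 0 r \<Longrightarrow> dist (\<Sum>i<n. c i * z ^ i) (\<Sum>i. c i * z ^ i) < \<epsilon>"
    by (fastforce simp: eventually_sequentially)
  show ?thesis
  proof (rule that)
    show "(\<lambda>z. \<Sum>i<n. c i * z ^ i) holomorphic_on UNIV"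
      by (intro holomorphic_intros)
    show "norm (e z - (\<Sum>i<n. c i * z ^ i)) < \<epsilon>" if "z \<in> cball 0 r" for z
      using n[OF that] sums_unique[OF sums[of z]] that r by (simp add: dist_norm norm_minus_commute)
  qed
qed

text \<open>Patching of local solutions. On the discs of radius \<open>n + 1\<close> there are solutions \<open>(s\<^sub>n, t\<^sub>n)\<close> by
  \<open>bezout_on_finite_zeros\<close>. Two solutions on the same disc differ by a multiple \<open>e\<^sub>n\<close> of the syzygy
  \<open>(- g, f)\<close>, where \<open>e\<^sub>n\<close> is the determinant of the two solutions and so is holomorphic on the disc
  without any division. Replacing \<open>e\<^sub>n\<close> by its error against an entire approximation \<open>q\<^sub>n\<close> amounts
  to changing all later solutions by an entire multiple of the syzygy, which leaves them solutions.
  After these changes, consecutive solutions are so close that they converge locally uniformly.\<close>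

lemma bezout_entire:
  assumes f: "f holomorphic_on UNIV" and g: "g holomorphic_on UNIV"
    and no: "\<And>z. f z = 0 \<Longrightarrow> g z \<noteq> 0"
  shows "bezout_on UNIV f g"
proof (cases "f = (\<lambda>z. 0)")
  case True
  then have "\<forall>z. g z \<noteq> 0" using no by simp
  then show ?thesis
    unfolding bezout_on_def
    by (intro exI[of _ "\<lambda>z. 0"] exI[of _ "\<lambda>z. inverse (g z)"] conjI holomorphic_intros g) auto
next
  case False
  note fS = holomorphic_on_subset[OF f subset_UNIV] and gS = holomorphic_on_subset[OF g subset_UNIV]
  have "bezout_on (ball 0 (real n + 1)) f g" for n
  proof (rule bezout_on_finite_zeros)
    show "infinite (ball (0::complex) (real n + 1))"
      using finite_imp_not_open[of "ball (0::complex) (real n + 1)"] by auto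
    have "finite {z \<in> cball 0 (real n + 1). f z = 0}"
      by (rule finite_zeros_entire[OF f False])
    then show "finite {z \<in> ball 0 (real n + 1). f z = 0}"
      by (rule rev_finite_subset) auto
  qed (use no in \<open>auto intro!: fS gS\<close>)
  then obtain s t where s: "\<And>n. s n holomorphic_on ball 0 (real n + 1)"
    and t: "\<And>n. t n holomorphic_on ball 0 (real n + 1)"
    and st: "\<And>n z. z \<in> ball 0 (real n + 1) \<Longrightarrow> s n z * f z + t n z * g z = 1"
    unfolding bezout_on_def by metis
  define e where "e = (\<lambda>n z. s n z * t (Suc n) z - t n z * s (Suc n) z)"
  have se: "s (Suc n) z - s n z = - (e n z * g z)" and te: "t (Suc n) z - t n z = e n z * f z"
    if "norm z \<le> n" for n z
  proof -
    have 1: "s n z * f z + t n z * g z = 1" "s (Suc n) z * f z + t (Suc n) z * g z = 1"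
      using that by (auto intro!: st)
    have "e n z * g z = s n z * (t (Suc n) z * g z) - s (Suc n) z * (t n z * g z)"
      by (simp add: e_def algebra_simps)
    also have "\<dots> = s n z * (1 - s (Suc n) z * f z) - s (Suc n) z * (1 - s n z * f z)"
      using 1 by (metis add_diff_cancel_left')
    finally show "s (Suc n) z - s n z = - (e n z * g z)" by (simp add: algebra_simps)
    have "e n z * f z = (s n z * f z) * t (Suc n) z - t n z * (s (Suc n) z * f z)"
      by (simp add: e_def algebra_simps)
    also have "\<dots> = (1 - t n z * g z) * t (Suc n) z - t n z * (1 - t (Suc n) z * g z)"
      using 1 by (metis add_diff_cancel_right')
    finally show "t (Suc n) z - t n z = e n z * f z" by (simp add: algebra_simps)
  qed
  \<comment> \<open>The error is weighted by \<open>f\<close> and \<open>g\<close> because these are the components of the syzygy.\<close>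
  have "\<exists>q. q holomorphic_on UNIV \<and> (\<forall>z. norm z \<le> n \<longrightarrow>
      norm ((e n z - q z) * f z) \<le> (1/2) ^ n \<and> norm ((e n z - q z) * g z) \<le> (1/2) ^ n)" for n
  proof -
    have "bounded ((\<lambda>z. norm (f z) + norm (g z)) ` cball 0 (real n))"
      by (intro compact_imp_bounded compact_continuous_image continuous_intros
          holomorphic_on_imp_continuous_on fS gS) auto
    then obtain K where K: "K > 0" "\<And>z. norm z \<le> n \<Longrightarrow> norm (f z) + norm (g z) \<le> K"
      unfolding bounded_pos by force
    have "e n holomorphic_on ball 0 (real n + 1)"
      unfolding e_def
      by (intro holomorphic_intros s t holomorphic_on_subset[OF s[of "Suc n"]]
          holomorphic_on_subset[OF t[of "Suc n"]]) auto
    then obtain q where q: "q holomorphic_on UNIV"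
      "\<And>z. z \<in> cball 0 n \<Longrightarrow> norm (e n z - q z) < (1/2) ^ n / K"
      using K by (elim holomorphic_ball_entire_approximation[where r = n and \<epsilon> = "(1/2)^n / K"]) auto
    have "norm ((e n z - q z) * u) \<le> (1/2) ^ n" if "norm z \<le> n" "norm u \<le> K" for z u
    proof -
      have "norm ((e n z - q z) * u) \<le> (1/2) ^ n / K * K"
        unfolding norm_mult
      proof (rule mult_mono)
        show "norm (e n z - q z) \<le> (1/2) ^ n / K" using q(2)[of z] that(1) by simp
        show "0 \<le> (1/2) ^ n / K" using K(1) by simp
      qed (use that(2) in simp_all)
      then show ?thesis using K(1) by simp
    qed
    moreover have "norm (f z) \<le> K" "norm (g z) \<le> K" if "norm z \<le> n" for z
      using K(2)[OF that] norm_ge_zero[of "f z"] norm_ge_zero[of "g z"] by linarith+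
    ultimately show ?thesis using q by blast
  qed
  then obtain q where q: "\<And>n. q n holomorphic_on UNIV"
    and qf: "\<And>n z. norm z \<le> real n \<Longrightarrow> norm ((e n z - q n z) * f z) \<le> (1/2) ^ n"
    and qg: "\<And>n z. norm z \<le> real n \<Longrightarrow> norm ((e n z - q n z) * g z) \<le> (1/2) ^ n"
    by metis
  define Q where "Q = (\<lambda>n z. \<Sum>k<n. q k z)"
  have Q: "Q n holomorphic_on A" for n A
    unfolding Q_def by (intro holomorphic_intros holomorphic_on_subset[OF q]) auto
  define s' t' where "s' = (\<lambda>n z. s n z + Q n z * g z)" and "t' = (\<lambda>n z. t n z - Q n z * f z)"
  obtain s'' where s'': "s'' holomorphic_on UNIV" "\<And>z. (\<lambda>n. s' n z) \<longlonglongrightarrow> s'' z"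
  proof (rule holomorphic_limit_of_geometric_steps)
    show "s' n holomorphic_on ball 0 (real n + 1)" for n
      unfolding s'_def by (intro holomorphic_intros s Q gS)
    show "norm (s' (Suc n) z - s' n z) \<le> (1/2) ^ n" if "norm z \<le> n" for n z
    proof -
      have "s' (Suc n) z - s' n z = - ((e n z - q n z) * g z)"
        using se[OF that] by (simp add: s'_def Q_def algebra_simps)
      then show ?thesis using qg[OF that] by (metis norm_minus_cancel)
    qed
  qed (rule that)
  obtain t'' where t'': "t'' holomorphic_on UNIV" "\<And>z. (\<lambda>n. t' n z) \<longlonglongrightarrow> t'' z"
  proof (rule holomorphic_limit_of_geometric_steps)
    show "t' n holomorphic_on ball 0 (real n + 1)" for n
      unfolding t'_def by (intro holomorphic_intros t Q fS)
    show "norm (t' (Suc n) z - t' n z) \<le> (1/2) ^ n" if "norm z \<le> n" for n z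
    proof -
      have "t' (Suc n) z - t' n z = (e n z - q n z) * f z"
        using te[OF that] by (simp add: t'_def Q_def algebra_simps)
      then show ?thesis using qf[OF that] by simp
    qed
  qed (rule that)
  have "s'' z * f z + t'' z * g z = 1" for z
  proof (rule LIMSEQ_unique)
    show "(\<lambda>n. s' n z * f z + t' n z * g z) \<longlonglongrightarrow> s'' z * f z + t'' z * g z"
      by (intro tendsto_intros s'' t'')
    obtain N :: nat where N: "norm z < N" using reals_Archimedean2 by blast
    have "s' n z * f z + t' n z * g z = 1" if "N \<le> n" for n
    proof -
      have "s n z * f z + t n z * g z = 1" using N that by (intro st) auto
      then show ?thesis by (simp add: s'_def t'_def algebra_simps)
    qed
    then have "\<forall>\<^sub>F n in sequentially. s' n z * f z + t' n z * g z = 1"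
      by (auto simp: eventually_sequentially)
    then show "(\<lambda>n. s' n z * f z + t' n z * g z) \<longlonglongrightarrow> 1" by (rule tendsto_eventually)
  qed
  then show ?thesis
    unfolding bezout_on_def using s''(1) t''(1) by (intro exI[of _ s''] exI[of _ t''] conjI ballI)
qed


section \<open>Entire functions\<close>

text \<open>A Weierstrass product over the nonzero points of \<open>D\<close>, with a separate factor for the origin, as the
  elementary factors \<open>z / a\<close> need \<open>a \<noteq> 0\<close>.\<close>

lemma entire_with_prescribed_zeros:
  fixes D :: "complex set"
  assumes D: "closed D \<and> discrete D"
  obtains f where "f holomorphic_on UNIV" "\<And>z. f z = 0 \<longleftrightarrow> z \<in> D"
proof (cases "finite D")
  case True
  show ?thesis
  proof (rule that)
    show "(\<lambda>z. \<Prod>a\<in>D. z - a) holomorphic_on UNIV" by (intro holomorphic_intros)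
    show "(\<Prod>a\<in>D. z - a) = 0 \<longleftrightarrow> z \<in> D" for z using True by auto
  qed
next
  case False
  have D0: "closed (D - {0}) \<and> discrete (D - {0})"
    using closed_discrete_Int[OF D, of "- {0}"] by (simp add: Diff_eq)
  obtain a :: "nat \<Rightarrow> complex"
    where a: "inj a" "range a = D - {0}" "filterlim a at_infinity at_top"
  proof (rule sequence_of_sparse_set_exists)
    show "infinite (D - {0})" using False by simp
    show "closed (D - {0})" using D0 by simp
    show "finite ((D - {0}) \<inter> cball 0 r)" for r
      using D0 unfolding closed_discrete_iff_finite_cball by blast
  qed (rule that)
  interpret W: weierstrass_product' a
  proof
    show "a n \<noteq> 0" for n using a(2) by (metis DiffD2 rangeI singletonI)
    show "finite (a -` {z})" for z using a(1) by (simp add: finite_vimageI)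
  qed (rule a(3))
  show ?thesis
  proof (rule that)
    show "(\<lambda>z. (if 0 \<in> D then z else 1) * W.f z) holomorphic_on UNIV"
      by (cases "0 \<in> D") (auto intro!: holomorphic_intros W.holomorphic)
    show "(if 0 \<in> D then z else 1) * W.f z = 0 \<longleftrightarrow> z \<in> D" for z
      using a(2) by (auto simp: W.zero)
  qed
qed

theorem structure_space_entire_ring:
  "structure_space entire_ring homeomorphic_space (theta_space :: complex set set topology)"
proof -
  interpret zero_set_ring "{f. f holomorphic_on UNIV}" "\<lambda>z::complex. z"
  proof (rule zero_set_ring.intro)
    show "cring (function_ring {f :: complex \<Rightarrow> complex. f holomorphic_on UNIV})"
      using cring_entire_ring by (simp add: entire_ring_def)
    show "(\<lambda>_. of_real c) \<in> {f :: complex \<Rightarrow> complex. f holomorphic_on UNIV}" for c by simp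
  next
    fix f :: "complex \<Rightarrow> complex"
    assume "f \<in> {f. f holomorphic_on UNIV}" "f \<noteq> (\<lambda>_. 0)"
    then show "closed {z. f z = 0} \<and> discrete {z. f z = 0}"
      unfolding closed_discrete_iff_finite_cball using finite_zeros_entire[of f]
      by (simp add: Int_def conj_commute)
  next
    fix D :: "complex set" assume "closed D" "discrete D"
    then obtain f where "f holomorphic_on UNIV" "\<And>z. f z = 0 \<longleftrightarrow> z \<in> D"
      using entire_with_prescribed_zeros by blast
    then show "\<exists>f\<in>{f. f holomorphic_on UNIV}. {z. f z = 0} = D" by auto
  next
    fix f g :: "complex \<Rightarrow> complex"
    assume "f \<in> {f. f holomorphic_on UNIV}" "g \<in> {f. f holomorphic_on UNIV}"
      "\<And>z. f z = 0 \<Longrightarrow> g z \<noteq> 0"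
    then show "\<exists>s\<in>{f. f holomorphic_on UNIV}. \<exists>t\<in>{f. f holomorphic_on UNIV}.
        \<forall>z. s z * f z + t z * g z = 1"
      using bezout_entire[of f g] by (auto simp: bezout_on_def)
  qed
  show ?thesis using structure_space_homeomorphic_theta by (simp add: entire_ring_def)
qed


section \<open>Entire functions with real Taylor coefficients\<close>

text \<open>If \<open>f\<close> commutes with conjugation, its Taylor coefficients may be replaced by their conjugates; the
  average of the two series has the real parts as coefficients.\<close>

lemma real_power_series_iff:
  "(\<exists>a::nat \<Rightarrow> real. \<forall>z. (\<lambda>n. complex_of_real (a n) * z ^ n) sums f z)
    \<longleftrightarrow> f holomorphic_on UNIV \<and> (\<forall>z. cnj (f (cnj z)) = f z)"
proof (intro iffI)
  assume "\<exists>a::nat \<Rightarrow> real. \<forall>z. (\<lambda>n. complex_of_real (a n) * z ^ n) sums f z"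
  then obtain a where a: "\<And>z. (\<lambda>n. complex_of_real (a n) * z ^ n) sums f z" by blast
  have "f holomorphic_on ball 0 r" for r
    by (rule power_series_holomorphic[where a = "\<lambda>n. complex_of_real (a n)"]) (use a in simp)
  moreover have "z \<in> ball 0 (norm z + 1)" for z :: complex by simp
  ultimately have "f holomorphic_on UNIV"
    by (metis at_within_open holomorphic_on_def open_UNIV open_ball UNIV_I)
  moreover have "cnj (f (cnj z)) = f z" for z
  proof (rule sums_unique2[OF _ a[of z]])
    show "(\<lambda>n. complex_of_real (a n) * z ^ n) sums cnj (f (cnj z))"
      using sums_cnj[THEN iffD2, OF a[of "cnj z"]] by simp
  qed
  ultimately show "f holomorphic_on UNIV \<and> (\<forall>z. cnj (f (cnj z)) = f z)" by blast
next
  assume f: "f holomorphic_on UNIV \<and> (\<forall>z. cnj (f (cnj z)) = f z)"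
  define c where "c = (\<lambda>n. (deriv ^^ n) f 0 / fact n)"
  have c: "(\<lambda>n. c n * z ^ n) sums f z" for z
  proof -
    have "f holomorphic_on ball 0 (norm z + 1)" using f holomorphic_on_subset by blast
    from holomorphic_power_series[OF this, of z] show ?thesis by (simp add: c_def)
  qed
  have "(\<lambda>n. complex_of_real (Re (c n)) * z ^ n) sums f z" for z
  proof -
    have "(\<lambda>n. cnj (c n) * z ^ n) sums f z"
      using sums_cnj[THEN iffD2, OF c[of "cnj z"]] f by simp
    from sums_divide[OF sums_add[OF c[of z] this], of 2]
    have "(\<lambda>n. (c n * z ^ n + cnj (c n) * z ^ n) / 2) sums f z" by simp
    moreover have "(c n * z ^ n + cnj (c n) * z ^ n) / 2 = complex_of_real (Re (c n)) * z ^ n" for n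
      unfolding distrib_right[symmetric] complex_add_cnj by simp
    ultimately show ?thesis by simp
  qed
  then show "\<exists>a::nat \<Rightarrow> real. \<forall>z. (\<lambda>n. complex_of_real (a n) * z ^ n) sums f z"
    by (intro exI[of _ "\<lambda>n. Re (c n)"] allI)
qed

text \<open>On every circle around the origin, a suitably scaled square root, turned by a right angle, embeds
  the circle into its closed upper half, and the Schroeder-Bernstein theorem provides a bijection.
  It cannot be continuous, since a circle is not homeomorphic to an arc, but no continuity is asked for.\<close>

lemma norm_preserving_bijection_half_plane:
  obtains \<phi> :: "complex \<Rightarrow> complex"
  where "inj \<phi>" "range \<phi> = {z. Im z \<ge> 0}" "\<And>z. norm (\<phi> z) = norm z"
proof -
  have "\<exists>h. bij_betw h (sphere (0::complex) r) {z \<in> sphere 0 r. Im z \<ge> 0}" for r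
  proof (rule Schroeder_Bernstein)
    define k :: "complex \<Rightarrow> complex" where "k = (\<lambda>z. \<i> * csqrt z * of_real (sqrt r))"
    have "k z ^ 2 = - (z * of_real r)" if "r \<ge> 0" for z
      using that by (simp add: k_def power_mult_distrib flip: of_real_power)
    then show "inj_on k (sphere 0 r)"
      by (intro inj_onI) (metis mem_sphere_0 mult_right_cancel neg_equal_iff_equal norm_eq_zero norm_ge_zero of_real_eq_0_iff)
    show "k ` sphere 0 r \<subseteq> {z \<in> sphere 0 r. Im z \<ge> 0}"
    proof safe
      fix z :: complex assume z: "z \<in> sphere 0 r"
      then have r: "r = norm z" by simp
      have "sqrt (norm z) * sqrt (norm z) = norm z" by simp
      then show "k z \<in> sphere 0 r"
        by (simp add: k_def norm_mult r)
      show "0 \<le> Im (k z)" using Re_csqrt[of z] by (simp add: k_def r)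
    qed
    show "inj_on id {z \<in> sphere 0 r. Im z \<ge> 0}" by simp
    show "id ` {z \<in> sphere 0 r. Im z \<ge> 0} \<subseteq> sphere (0::complex) r" by auto
  qed
  then obtain h where h: "\<And>r. bij_betw (h r) (sphere (0::complex) r) {z \<in> sphere 0 r. Im z \<ge> 0}"
    by metis
  define \<phi> where "\<phi> = (\<lambda>z. h (norm z) z)"
  have mem: "\<phi> z \<in> {w \<in> sphere 0 (norm z). Im w \<ge> 0}" for z
    unfolding \<phi>_def by (rule bij_betwE[OF h, rule_format]) simp
  show ?thesis
  proof (rule that)
    show norm: "norm (\<phi> z) = norm z" for z using mem[of z] by simp
    show "inj \<phi>"
    proof (rule injI)
      fix z w assume eq: "\<phi> z = \<phi> w"
      then have "norm z = norm w" by (metis norm)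
      with eq have "h (norm z) z = h (norm z) w" by (simp add: \<phi>_def)
      then show "z = w"
        using bij_betw_imp_inj_on[OF h[of "norm z"]] \<open>norm z = norm w\<close> by (simp add: inj_on_eq_iff)
    qed
    show "range \<phi> = {z. Im z \<ge> 0}"
    proof (intro equalityI subsetI)
      fix w assume w: "w \<in> {z. Im z \<ge> 0}"
      then have "w \<in> h (norm w) ` sphere 0 (norm w)"
        using bij_betw_imp_surj_on[OF h[of "norm w"]] by auto
      then obtain z where "norm z = norm w" "w = h (norm w) z" by auto
      then have "w = \<phi> z" by (simp add: \<phi>_def)
      then show "w \<in> range \<phi>" by blast
    qed (use mem in auto)
  qed
qed

definition cnj_symmetric_entire :: "(complex \<Rightarrow> complex) set"
  where "cnj_symmetric_entire = {f. f holomorphic_on UNIV \<and> (\<forall>z. cnj (f (cnj z)) = f z)}"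

lemma real_entire_ring_eq: "real_entire_ring = function_ring cnj_symmetric_entire"
  by (simp add: real_entire_ring_def cnj_symmetric_entire_def real_power_series_iff)

lemma holomorphic_cnj_cnj:
  "f holomorphic_on UNIV \<Longrightarrow> (\<lambda>z. cnj (f (cnj z))) holomorphic_on UNIV"
  using holomorphic_on_compose_cnj_cnj[of f UNIV] holomorphic_on_subset[of f UNIV "range cnj"]
  by (simp add: o_def)

text \<open>Multiplying a function by its conjugate \<open>z \<mapsto> cnj (h (cnj z))\<close> makes it symmetric, and does not add
  zeros if the zero set is symmetric.\<close>

lemma cnj_symmetric_entire_with_prescribed_zeros:
  fixes D :: "complex set"
  assumes D: "closed D \<and> discrete D" and sym: "\<And>z. z \<in> D \<Longrightarrow> cnj z \<in> D"
  obtains f where "f \<in> cnj_symmetric_entire" "\<And>z. f z = 0 \<longleftrightarrow> z \<in> D"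
proof -
  obtain h where h: "h holomorphic_on UNIV" "\<And>z. h z = 0 \<longleftrightarrow> z \<in> D"
    using entire_with_prescribed_zeros[OF D] by blast
  show ?thesis
  proof (rule that)
    show "(\<lambda>z. h z * cnj (h (cnj z))) \<in> cnj_symmetric_entire"
      using h(1) holomorphic_cnj_cnj by (auto simp: cnj_symmetric_entire_def mult.commute intro!: holomorphic_intros)
    show "h z * cnj (h (cnj z)) = 0 \<longleftrightarrow> z \<in> D" for z
      using h(2) sym[of "cnj z"] by auto
  qed
qed

text \<open>Averaging the coefficient functions of a Bezout identity with their conjugates makes them symmetric. By
  symmetry of the zeros it is enough to exclude common zeros in the closed upper half-plane.\<close>

lemma bezout_cnj_symmetric_entire:
  assumes f: "f \<in> cnj_symmetric_entire" and g: "g \<in> cnj_symmetric_entire"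
    and no: "\<And>z. Im z \<ge> 0 \<Longrightarrow> f z = 0 \<Longrightarrow> g z \<noteq> 0"
  shows "\<exists>s\<in>cnj_symmetric_entire. \<exists>t\<in>cnj_symmetric_entire. \<forall>z. s z * f z + t z * g z = 1"
proof -
  have fg: "f holomorphic_on UNIV" "g holomorphic_on UNIV"
    "\<And>z. cnj (f (cnj z)) = f z" "\<And>z. cnj (g (cnj z)) = g z"
    using f g by (auto simp: cnj_symmetric_entire_def)
  have "g z \<noteq> 0" if "f z = 0" for z
  proof (cases "Im z \<ge> 0")
    case False
    then show ?thesis using no[of "cnj z"] that fg(3,4)[of "cnj z"] by auto
  qed (use no that in blast)
  then have "bezout_on UNIV f g" using bezout_entire fg by blast
  then obtain s t where st: "s holomorphic_on UNIV" "t holomorphic_on UNIV"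
    "\<And>z. s z * f z + t z * g z = 1"
    by (auto simp: bezout_on_def)
  have avg: "(\<lambda>z. (u z + cnj (u (cnj z))) / 2) \<in> cnj_symmetric_entire" if "u holomorphic_on UNIV" for u
    using that holomorphic_cnj_cnj[OF that]
    by (auto simp: cnj_symmetric_entire_def add.commute intro!: holomorphic_intros)
  have "(s z + cnj (s (cnj z))) / 2 * f z + (t z + cnj (t (cnj z))) / 2 * g z = 1" for z
  proof -
    have "cnj (s (cnj z) * f (cnj z) + t (cnj z) * g (cnj z)) = 1" by (simp only: st complex_cnj_one)
    then have "cnj (s (cnj z)) * f z + cnj (t (cnj z)) * g z = 1" by (simp add: fg)
    moreover have "(s z + cnj (s (cnj z))) / 2 * f z + (t z + cnj (t (cnj z))) / 2 * g z
        = ((s z * f z + t z * g z) + (cnj (s (cnj z)) * f z + cnj (t (cnj z)) * g z)) / 2"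
      by (simp add: field_simps)
    ultimately show ?thesis by (simp add: st(3))
  qed
  then show ?thesis
    by (intro bexI[OF _ avg[OF st(1)]] bexI[OF _ avg[OF st(2)]] allI)
qed

text \<open>Every conjugation orbit has exactly one point in the closed upper half-plane, so a symmetric zero
  set is determined by its trace there. The closed discrete subsets of the half-plane correspond to
  those of the plane under a norm-preserving bijection.\<close>

theorem structure_space_real_entire_ring:
  "structure_space real_entire_ring homeomorphic_space (theta_space :: complex set set topology)"
proof -
  obtain \<phi> :: "complex \<Rightarrow> complex"
    where \<phi>: "inj \<phi>" "range \<phi> = {z. Im z \<ge> 0}" "\<And>z. norm (\<phi> z) = norm z"
    using norm_preserving_bijection_half_plane by metis
  have Im_\<phi>: "Im (\<phi> z) \<ge> 0" for z using \<phi>(2) by blast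
  interpret zero_set_ring cnj_symmetric_entire \<phi>
  proof (rule zero_set_ring.intro)
    show "cring (function_ring cnj_symmetric_entire)"
      using cring_real_entire_ring by (simp add: real_entire_ring_eq)
    show "(\<lambda>_. of_real c) \<in> cnj_symmetric_entire" for c by (simp add: cnj_symmetric_entire_def)
  next
    fix f assume "f \<in> cnj_symmetric_entire" "f \<noteq> (\<lambda>_. 0)"
    then have fin: "finite {z \<in> cball 0 r. f z = 0}" for r
      using finite_zeros_entire[of f] by (simp add: cnj_symmetric_entire_def)
    show "closed {x. f (\<phi> x) = 0} \<and> discrete {x. f (\<phi> x) = 0}"
      unfolding closed_discrete_iff_finite_cball
    proof
      fix r
      have sub: "\<phi> ` ({x. f (\<phi> x) = 0} \<inter> cball 0 r) \<subseteq> {z \<in> cball 0 r. f z = 0}" by (auto simp: \<phi>)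
      show "finite ({x. f (\<phi> x) = 0} \<inter> cball 0 r)"
        by (rule finite_imageD[OF finite_subset[OF sub fin] inj_on_subset[OF \<phi>(1) subset_UNIV]])
    qed
  next
    fix D :: "complex set" assume D: "closed D" "discrete D"
    let ?E = "\<phi> ` D \<union> cnj ` \<phi> ` D"
    have E: "closed ?E \<and> discrete ?E"
      unfolding closed_discrete_iff_finite_cball
    proof
      fix r
      have "?E \<inter> cball 0 r \<subseteq> \<phi> ` (D \<inter> cball 0 r) \<union> cnj ` \<phi> ` (D \<inter> cball 0 r)" by (auto simp: \<phi>)
      moreover have "finite (D \<inter> cball 0 r)" using D closed_discrete_iff_finite_cball by blast
      ultimately show "finite (?E \<inter> cball 0 r)" by (meson finite_UnI finite_imageI finite_subset)
    qed
    have sym: "cnj z \<in> ?E" if "z \<in> ?E" for z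
      using that by (elim UnE imageE) (auto intro!: imageI)
    obtain f where f: "f \<in> cnj_symmetric_entire" "\<And>z. f z = 0 \<longleftrightarrow> z \<in> ?E"
      using cnj_symmetric_entire_with_prescribed_zeros[OF E sym] by blast
    have "\<phi> x \<in> ?E \<longleftrightarrow> x \<in> D" for x
    proof
      assume "\<phi> x \<in> ?E"
      then show "x \<in> D"
      proof
        assume "\<phi> x \<in> cnj ` \<phi> ` D"
        then obtain d where d: "d \<in> D" "\<phi> x = cnj (\<phi> d)" by blast
        \<comment> \<open>Both points are in the closed upper half-plane, so they are real.\<close>
        then have "Im (\<phi> d) = 0" using Im_\<phi>[of x] Im_\<phi>[of d] by simp
        then have "\<phi> x = \<phi> d" using d by (simp add: complex_eq_iff)
        then show ?thesis using d(1) injD[OF \<phi>(1)] by blast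
      qed (use inj_image_mem_iff[OF \<phi>(1)] in blast)
    qed simp
    then have "{x. f (\<phi> x) = 0} = D" by (simp only: f(2)) simp
    with f(1) show "\<exists>f\<in>cnj_symmetric_entire. {x. f (\<phi> x) = 0} = D" by blast
  next
    fix f g assume fg: "f \<in> cnj_symmetric_entire" "g \<in> cnj_symmetric_entire"
      and no: "\<And>x. f (\<phi> x) = 0 \<Longrightarrow> g (\<phi> x) \<noteq> 0"
    show "\<exists>s\<in>cnj_symmetric_entire. \<exists>t\<in>cnj_symmetric_entire. \<forall>y. s y * f y + t y * g y = 1"
    proof (rule bezout_cnj_symmetric_entire[OF fg])
      fix z assume "Im z \<ge> 0" "f z = 0"
      then obtain x where "z = \<phi> x" using \<phi>(2) by blast
      then show "g z \<noteq> 0" using no \<open>f z = 0\<close> by simp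
    qed
  qed
  show ?thesis using structure_space_homeomorphic_theta by (simp add: real_entire_ring_eq)
qed


section \<open>Real analytic functions\<close>

definition real_analytic :: "(real \<Rightarrow> real) set"
  where "real_analytic = {f. \<forall>x. \<exists>F. (\<lambda>h. f (x + h)) has_fps_expansion F}"

text \<open>Division by the leading power leaves a continuous function that does not vanish at the origin.\<close>

lemma has_fps_expansion_zero_or_eventually_nonzero:
  fixes f :: "real \<Rightarrow> real"
  assumes F: "f has_fps_expansion F"
  shows "(\<forall>\<^sub>F h in nhds 0. f h = 0) \<or> (\<forall>\<^sub>F h in at 0. f h \<noteq> 0)"
proof (cases "F = 0")
  case True
  then have "\<forall>\<^sub>F h in nhds 0. eval_fps 0 h = f h" using F by (simp add: has_fps_expansion_def)
  then have "\<forall>\<^sub>F h in nhds 0. f h = 0" by eventually_elim simp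
  then show ?thesis ..
next
  case False
  define n where "n = subdegree F"
  define g where "g = (\<lambda>h. if h = 0 then fps_nth F n else f h / h ^ n)"
  have "g has_fps_expansion fps_shift n F"
    unfolding g_def by (rule has_fps_expansion_shift[OF F]) (simp_all add: n_def)
  then have "(g \<longlongrightarrow> g 0) (at 0)"
    using has_fps_expansion_imp_continuous[of g] by (simp add: continuous_within)
  moreover have "g 0 \<noteq> 0" using False by (simp add: g_def n_def)
  ultimately have "\<forall>\<^sub>F h in at 0. g h \<noteq> 0" by (rule tendsto_imp_eventually_ne)
  moreover have "\<forall>\<^sub>F h in at (0::real). h \<noteq> 0" by (simp add: eventually_at_filter)
  ultimately have "\<forall>\<^sub>F h in at 0. f h \<noteq> 0"
    by eventually_elim (auto simp: g_def)
  then show ?thesis ..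
qed

text \<open>Identity theorem: the set where \<open>f\<close> vanishes locally is open, and so is its complement, as a point of
  the complement has a punctured neighbourhood without zeros. By connectedness of the line, the
  set is empty unless \<open>f\<close> is zero everywhere.\<close>

lemma zeros_real_analytic:
  assumes f: "f \<in> real_analytic" and nz: "f \<noteq> (\<lambda>_. 0)"
  shows "closed {x. f x = 0} \<and> discrete {x. f x = 0}"
proof -
  have dich: "(\<forall>\<^sub>F y in nhds x. f y = 0) \<or> (\<forall>\<^sub>F y in at x. f y \<noteq> 0)" for x
  proof -
    obtain F where "(\<lambda>h. f (x + h)) has_fps_expansion F" using f by (auto simp: real_analytic_def)
    moreover have "nhds x = filtermap (\<lambda>h. h + x) (nhds 0)" "at x = filtermap (\<lambda>h. h + x) (at 0)"
      using filtermap_nhds_shift[of "- x" 0] at_to_0[of x] by simp_all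
    ultimately show ?thesis
      using has_fps_expansion_zero_or_eventually_nonzero
      by (simp add: eventually_filtermap add.commute)
  qed
  define S where "S = {x. \<forall>\<^sub>F y in nhds x. f y = 0}"
  have "open S"
    unfolding open_subopen[of S]
  proof
    fix x assume "x \<in> S"
    then obtain U where "open U" "x \<in> U" "\<forall>y\<in>U. f y = 0" by (auto simp: S_def eventually_nhds)
    then show "\<exists>T. open T \<and> x \<in> T \<and> T \<subseteq> S" by (auto simp: S_def eventually_nhds)
  qed
  moreover have "open (- S)"
    unfolding open_subopen[of "- S"]
  proof
    fix x assume x: "x \<in> - S"
    then have "\<forall>\<^sub>F y in at x. f y \<noteq> 0" using dich by (auto simp: S_def)
    then obtain U where U: "open U" "x \<in> U" "\<forall>y\<in>U. y \<noteq> x \<longrightarrow> f y \<noteq> 0"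
      by (auto simp: eventually_at_topological)
    have "y \<notin> S" if "y \<in> U" for y
      using that U(3) x eventually_nhds_x_imp_x[of "\<lambda>y. f y = 0" y] by (cases "y = x") (auto simp: S_def)
    with U show "\<exists>T. open T \<and> x \<in> T \<and> T \<subseteq> - S" by blast
  qed
  ultimately have "S = {} \<or> S = UNIV" using clopen[of S] by (auto simp: closed_def)
  moreover have "S \<noteq> UNIV"
  proof
    assume "S = UNIV"
    then have "f x = 0" for x
      using eventually_nhds_x_imp_x[of "\<lambda>y. f y = 0" x] by (auto simp: S_def)
    then show False using nz by auto
  qed
  ultimately have "\<forall>\<^sub>F y in at x. f y \<noteq> 0" for x using dich[of x] by (auto simp: S_def)
  then show ?thesis unfolding closed_discrete_iff by simp
qed

text \<open>Translation by a real number preserves the symmetry, so the Taylor coefficients at every real point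
  are real.\<close>

lemma cnj_symmetric_entire_imp_real_analytic:
  assumes f: "f \<in> cnj_symmetric_entire"
  shows "(\<lambda>x. Re (f (of_real x))) \<in> real_analytic"
  unfolding real_analytic_def mem_Collect_eq
proof
  fix x :: real
  have "f holomorphic_on UNIV" using f by (simp add: cnj_symmetric_entire_def)
  then have "(\<lambda>z. f (of_real x + z)) holomorphic_on UNIV"
    by (intro holomorphic_on_compose_gen[of "\<lambda>z. of_real x + z" UNIV f UNIV, unfolded o_def] holomorphic_intros) auto
  moreover have "cnj (f (of_real x + cnj z)) = f (of_real x + z)" for z
  proof -
    have "cnj (f (cnj (of_real x + z))) = f (of_real x + z)"
      using f unfolding cnj_symmetric_entire_def by blast
    then show ?thesis by simp
  qed
  ultimately obtain a :: "nat \<Rightarrow> real"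
    where "\<And>z. (\<lambda>n. complex_of_real (a n) * z ^ n) sums f (of_real x + z)"
    using real_power_series_iff[of "\<lambda>z. f (of_real x + z)"] by blast
  then have "(\<lambda>n. Re (complex_of_real (a n) * of_real h ^ n)) sums Re (f (of_real x + of_real h))" for h
    using sums_Re by blast
  then have a: "(\<lambda>n. a n * h ^ n) sums Re (f (of_real (x + h)))" for h
    by (simp flip: of_real_power of_real_mult)
  have "conv_radius a \<ge> norm (1::real)"
    by (rule conv_radius_geI) (use sums_summable[OF a[of 1]] in simp)
  then have "fps_conv_radius (Abs_fps a) > 0"
    using less_le_trans[of 0 "ereal (norm (1::real))" "conv_radius a"] by (simp add: fps_conv_radius_def)
  moreover have "eval_fps (Abs_fps a) h = Re (f (of_real (x + h)))" for h
    using sums_unique[OF a[of h]] by (simp add: eval_fps_def)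
  ultimately have "(\<lambda>h. Re (f (of_real (x + h)))) has_fps_expansion Abs_fps a"
    by (simp add: has_fps_expansion_def)
  then show "\<exists>F. (\<lambda>h. Re (f (of_real (x + h)))) has_fps_expansion F" ..
qed

text \<open>The restriction to the real line of a symmetric entire function with zeros on the line; it takes
  real values there.\<close>

lemma real_analytic_with_prescribed_zeros:
  fixes D :: "real set"
  assumes D: "closed D \<and> discrete D"
  obtains f where "f \<in> real_analytic" "\<And>x. f x = 0 \<longleftrightarrow> x \<in> D"
proof -
  let ?E = "complex_of_real ` D"
  have E: "closed ?E \<and> discrete ?E"
    unfolding closed_discrete_iff_finite_cball
  proof
    fix r
    have "?E \<inter> cball 0 r = complex_of_real ` (D \<inter> cball 0 r)" by auto
    moreover have "finite (D \<inter> cball 0 r)" using D closed_discrete_iff_finite_cball by blast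
    ultimately show "finite (?E \<inter> cball 0 r)" by simp
  qed
  obtain f where f: "f \<in> cnj_symmetric_entire" "\<And>z. f z = 0 \<longleftrightarrow> z \<in> ?E"
    using cnj_symmetric_entire_with_prescribed_zeros[OF E] by (metis complex_cnj_complex_of_real imageE)
  show ?thesis
  proof (rule that)
    show "(\<lambda>x. Re (f (of_real x))) \<in> real_analytic"
      using f(1) by (rule cnj_symmetric_entire_imp_real_analytic)
    fix x :: real
    have "cnj (f (cnj (of_real x))) = f (of_real x)"
      using f(1) unfolding cnj_symmetric_entire_def by blast
    then have "Im (f (of_real x)) = 0" by (simp add: complex_eq_iff)
    then have "Re (f (of_real x)) = 0 \<longleftrightarrow> f (of_real x) = 0" by (simp add: complex_eq_iff)
    then show "Re (f (of_real x)) = 0 \<longleftrightarrow> x \<in> D" using f(2) by auto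
  qed
qed

text \<open>The explicit solution \<open>f / (f\<^sup>2 + g\<^sup>2)\<close>, \<open>g / (f\<^sup>2 + g\<^sup>2)\<close>.\<close>

lemma bezout_real_analytic:
  assumes f: "f \<in> real_analytic" and g: "g \<in> real_analytic"
    and no: "\<And>x. f x = 0 \<Longrightarrow> g x \<noteq> 0"
  shows "\<exists>s\<in>real_analytic. \<exists>t\<in>real_analytic. \<forall>x. s x * f x + t x * g x = 1"
proof -
  define q where "q = (\<lambda>x. f x * f x + g x * g x)"
  have q0: "q x \<noteq> 0" for x using no[of x] by (simp add: q_def sum_squares_eq_zero_iff)
  have quot: "(\<lambda>x. u x * inverse (q x)) \<in> real_analytic" if u: "u \<in> real_analytic" for u
    unfolding real_analytic_def mem_Collect_eq
  proof
    fix x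
    obtain F G U where FGU: "(\<lambda>h. f (x + h)) has_fps_expansion F" "(\<lambda>h. g (x + h)) has_fps_expansion G"
      "(\<lambda>h. u (x + h)) has_fps_expansion U"
      using f g u unfolding real_analytic_def by blast
    have Q: "(\<lambda>h. q (x + h)) has_fps_expansion F * F + G * G"
      unfolding q_def by (intro has_fps_expansion_add has_fps_expansion_mult FGU)
    have "fps_nth (F * F + G * G) 0 = q x"
      using has_fps_expansion_imp_0_eq_fps_nth_0[OF Q] by simp
    then have "(\<lambda>h. u (x + h) * inverse (q (x + h))) has_fps_expansion U * inverse (F * F + G * G)"
      using q0 by (intro has_fps_expansion_mult has_fps_expansion_inverse FGU Q) simp
    then show "\<exists>F. (\<lambda>h. u (x + h) * inverse (q (x + h))) has_fps_expansion F" ..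
  qed
  have "f x * inverse (q x) * f x + g x * inverse (q x) * g x = 1" for x
  proof -
    have "f x * inverse (q x) * f x + g x * inverse (q x) * g x = q x * inverse (q x)"
      by (simp add: q_def algebra_simps)
    then show ?thesis using q0[of x] by simp
  qed
  then show ?thesis using quot[OF f] quot[OF g]
    by (intro bexI[of _ "\<lambda>x. f x * inverse (q x)"] bexI[of _ "\<lambda>x. g x * inverse (q x)"] allI) auto
qed

theorem structure_space_real_analytic_ring:
  "structure_space real_analytic_ring homeomorphic_space (theta_space :: real set set topology)"
proof -
  have eq: "real_analytic_ring = function_ring real_analytic"
    by (simp add: real_analytic_ring_def real_analytic_def)
  interpret zero_set_ring real_analytic "\<lambda>x::real. x"
  proof (rule zero_set_ring.intro)
    show "cring (function_ring real_analytic)" using cring_real_analytic_ring by (simp add: eq)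
    show "(\<lambda>_. of_real c) \<in> real_analytic" for c
      unfolding real_analytic_def using has_fps_expansion_const by blast
  next
    fix D :: "real set" assume "closed D" "discrete D"
    then obtain f where "f \<in> real_analytic" "\<And>x. f x = 0 \<longleftrightarrow> x \<in> D"
      using real_analytic_with_prescribed_zeros by blast
    then show "\<exists>f\<in>real_analytic. {x. f x = 0} = D" by auto
  qed (use zeros_real_analytic bezout_real_analytic in blast)+
  show ?thesis using structure_space_homeomorphic_theta by (simp add: eq)
qed


section \<open>The structure spaces of the three rings\<close>

theorem theorem3p8:
  shows "structure_space entire_ring homeomorphic_space
           (theta_space :: complex set set topology)
       \<and> structure_space real_entire_ring homeomorphic_space
           (theta_space :: complex set set topology)
       \<and> structure_space real_analytic_ring homeomorphic_space
           (theta_space :: real set set topology)"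
  using structure_space_entire_ring structure_space_real_entire_ring
    structure_space_real_analytic_ring
  by blast

end
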